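(* Let $\mathbb{K}$ be a field, $V$ a two-dimensional $\mathbb{K}$-vector space, and $\mathcal{A}=\{H_1,\dots,H_n\}$ a finite set of distinct one-dimensional linear subspaces of $V$. With the notation of the context: (1) every finite maximal connected component $C$ of $\Lambda'$ satisfies $C\subset \Lambda^{\circ}$, and the union of all finite maximal connected components of $\Lambda'$ equals $\Lambda^{\circ}\cap\Lambda'$; (2) the set of infinite maximal connected components of $\Lambda'$ is exactly $\{\Lambda_H \mid H\in\mathcal{A}\}$; (3) every maximal connected component of $\Lambda\setminus\Lambda'=\Delta^{-1}(\{0\})$ consists of a single point.
   Context: Let $S=\mathrm{Sym}(V^* )\cong\mathbb{K}[x,y]$, graded by polynomial degree, and for each $H\in\mathcal{A}$ fix a linear form $\alpha_H\in V^*$ with $\ker\alpha_H=H$. Let $\Lambda=\mathbb{N}^{n}$ ($\mathbb{N}=\mathbb{Z}_{\ge0}$); an element $\mu\in\Lambda$ is regarded as a multiplicity $\mu:\mathcal{A}\to\mathbb{N}$, $\mu_{H_i}=\mu_i$. For $\mu\in\Lambda$ let $D(\mathcal{A},\mu)=\{\delta\in \mathrm{Der}_{\mathbb{K}}(S)=S\partial_x\oplus S\partial_y \mid \delta(\alpha_H)\in \alpha_H^{\mu_H}S \text{ for all } H\in\mathcal{A}\}$; it is a free graded $S$-module of rank 2, and if $\{\theta,\theta'\}$ is a homogeneous basis (a derivation $f\partial_x+g\partial_y$ with $f,g$ homogeneous of degree $d$ has degree $d$), the exponents are $(\deg\theta,\deg\theta')$. Define $\Delta(\mu)=|\deg\theta-\deg\theta'|$.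 Order $\Lambda$ componentwise ($\mu\subset\nu$ iff $\mu_H\le\nu_H$ for all $H$), let $|\mu|=\sum_H\mu_H$, and write $\mu\mathrel{\dot\subset}\nu$ if $\mu\subset\nu$ and $|\nu|=|\mu|+1$. The Hasse graph has vertex set $\Lambda$ and edges $\{\mu,\nu\}$ with $\mu\mathrel{\dot\subset}\nu$; subsets of $\Lambda$ are regarded as induced subgraphs, and connected components are taken in these induced subgraphs. Let $\Lambda'=\Delta^{-1}(\mathbb{Z}_{>0})$, $\Lambda_H=\{\mu\in\Lambda\mid \mu_H>\tfrac12|\mu|\}$ for $H\in\mathcal{A}$, and $\Lambda^{\circ}=\{\mu\in\Lambda\mid \mu_H\le\tfrac12|\mu| \text{ for all } H\in\mathcal{A}\}$. *)

theory Defs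
  imports
    "HOL-Computational_Algebra.Polynomial"
    "HOL-Library.Function_Algebras"
    "HOL-Library.FuncSet"
begin

text \<open>
  The ring \<open>K[x,y]\<close> is \<^typ>\<open>'k poly poly\<close>: the inner indeterminate is \<open>x\<close>, the outer one is \<open>y\<close>,
  so the coefficient of \<open>x\<^sup>i y\<^sup>j\<close> in \<open>p\<close> is \<^term>\<open>coeff (coeff p j) i\<close>.
\<close>

definition homogeneous :: "nat \<Rightarrow> 'k::field poly poly \<Rightarrow> bool" where
  "homogeneous d p \<longleftrightarrow> (\<forall>i j. coeff (coeff p j) i \<noteq> 0 \<longrightarrow> i + j = d)"

text \<open>
  If \<open>(e1, e2)\<close> is a basis of \<open>V\<close> and \<open>(x, y)\<close> is the dual basis, a linear form \<open>\<phi>\<close> on \<open>V\<close> is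
  \<open>\<phi>(e1) x + \<phi>(e2) y\<close>; this is its image under the isomorphism of \<open>Sym(V\<^sup>*)\<close> with \<open>K[x,y]\<close>.
\<close>

definition form_poly :: "'v \<Rightarrow> 'v \<Rightarrow> ('v \<Rightarrow> 'k) \<Rightarrow> 'k::field poly poly" where
  "form_poly e1 e2 \<phi> = [:[:0, \<phi> e1:], [:\<phi> e2:]:]"

definition derivations :: "('k::field poly poly \<Rightarrow> 'k poly poly) set" where
  "derivations = {\<delta>. Vector_Spaces.linear (\<lambda>c. smult [:c:]) (\<lambda>c. smult [:c:]) \<delta> \<and>
                     (\<forall>p q. \<delta> (p * q) = \<delta> p * q + p * \<delta> q)}"

definition der_of ::
  "'k::field poly poly \<Rightarrow> 'k poly poly \<Rightarrow> 'k poly poly \<Rightarrow> 'k poly poly" where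
  "der_of f g = (\<lambda>p. f * map_poly pderiv p + g * pderiv p)" \<comment> \<open>\<open>f \<partial>\<^sub>x + g \<partial>\<^sub>y\<close>\<close>

text \<open>The zero derivation has every degree.\<close>

definition der_degree :: "('k::field poly poly \<Rightarrow> 'k poly poly) \<Rightarrow> nat \<Rightarrow> bool" where
  "der_degree \<delta> d \<longleftrightarrow> (\<exists>f g. homogeneous d f \<and> homogeneous d g \<and> \<delta> = der_of f g)"

definition der_scale ::
  "'k::field poly poly \<Rightarrow> ('k poly poly \<Rightarrow> 'k poly poly) \<Rightarrow> ('k poly poly \<Rightarrow> 'k poly poly)" where
  "der_scale s \<delta> = (\<lambda>p. s * \<delta> p)"

text \<open>
  A multiplicity on the finite set \<open>A\<close> is a function \<open>A \<rightarrow> \<nat>\<close>, made unique as a HOL function by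
  fixing its value outside \<open>A\<close> (extensional functions).
\<close>

definition Lam :: "'h set \<Rightarrow> ('h \<Rightarrow> nat) set" where
  "Lam A = A \<rightarrow>\<^sub>E UNIV"

definition msize :: "'h set \<Rightarrow> ('h \<Rightarrow> nat) \<Rightarrow> nat" where
  "msize A \<mu> = (\<Sum>H\<in>A. \<mu> H)"

definition mle :: "'h set \<Rightarrow> ('h \<Rightarrow> nat) \<Rightarrow> ('h \<Rightarrow> nat) \<Rightarrow> bool" where
  "mle A \<mu> \<nu> \<longleftrightarrow> (\<forall>H\<in>A. \<mu> H \<le> \<nu> H)"

definition mcover :: "'h set \<Rightarrow> ('h \<Rightarrow> nat) \<Rightarrow> ('h \<Rightarrow> nat) \<Rightarrow> bool" where
  "mcover A \<mu> \<nu> \<longleftrightarrow> mle A \<mu> \<nu> \<and> msize A \<nu> = msize A \<mu> + 1"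

definition hasse_edges :: "'h set \<Rightarrow> (('h \<Rightarrow> nat) \<times> ('h \<Rightarrow> nat)) set" where
  "hasse_edges A = {(\<mu>, \<nu>). \<mu> \<in> Lam A \<and> \<nu> \<in> Lam A \<and> (mcover A \<mu> \<nu> \<or> mcover A \<nu> \<mu>)}"

definition hasse_connected :: "'h set \<Rightarrow> ('h \<Rightarrow> nat) set \<Rightarrow> bool" where
  "hasse_connected A C \<longleftrightarrow>
     C \<noteq> {} \<and> C \<subseteq> Lam A \<and> (\<forall>\<mu>\<in>C. \<forall>\<nu>\<in>C. (\<mu>, \<nu>) \<in> (hasse_edges A \<inter> C \<times> C)\<^sup>*)"

definition max_components :: "'h set \<Rightarrow> ('h \<Rightarrow> nat) set \<Rightarrow> ('h \<Rightarrow> nat) set set" where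
  "max_components A X =
     {C. C \<subseteq> X \<and> hasse_connected A C \<and>
         (\<forall>D. D \<subseteq> X \<and> hasse_connected A D \<and> C \<subseteq> D \<longrightarrow> D = C)}"

definition Lam_H :: "'h set \<Rightarrow> 'h \<Rightarrow> ('h \<Rightarrow> nat) set" where
  "Lam_H A H = {\<mu> \<in> Lam A. real (\<mu> H) > real (msize A \<mu>) / 2}"

definition Lam_circ :: "'h set \<Rightarrow> ('h \<Rightarrow> nat) set" where
  "Lam_circ A = {\<mu> \<in> Lam A. \<forall>H\<in>A. real (\<mu> H) \<le> real (msize A \<mu>) / 2}"

text \<open>Below, \<open>a H\<close> is the polynomial of a defining linear form of the line \<open>H\<close>.\<close>

definition D_mod ::
  "'h set \<Rightarrow> ('h \<Rightarrow> 'k::field poly poly) \<Rightarrow> ('h \<Rightarrow> nat) \<Rightarrow> ('k poly poly \<Rightarrow> 'k poly poly) set" where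
  "D_mod A a \<mu> = {\<delta> \<in> derivations. \<forall>H\<in>A. a H ^ \<mu> H dvd \<delta> (a H)}"

definition homogeneous_basis ::
  "('k::field poly poly \<Rightarrow> 'k poly poly) set \<Rightarrow> ('k poly poly \<Rightarrow> 'k poly poly) \<Rightarrow> nat \<Rightarrow>
   ('k poly poly \<Rightarrow> 'k poly poly) \<Rightarrow> nat \<Rightarrow> bool" where
  "homogeneous_basis M \<theta> d \<theta>' d' \<longleftrightarrow>
     der_degree \<theta> d \<and> der_degree \<theta>' d' \<and> \<theta> \<noteq> \<theta>' \<and>
     \<not> module.dependent der_scale {\<theta>, \<theta>'} \<and> module.span der_scale {\<theta>, \<theta>'} = M"

text \<open>
  That \<open>D_mod A a \<mu>\<close> is free of rank 2 with a homogeneous basis, and that the degrees of such a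
  basis do not depend on its choice, is what makes the definite description below meaningful.
\<close>

definition Delta :: "'h set \<Rightarrow> ('h \<Rightarrow> 'k::field poly poly) \<Rightarrow> ('h \<Rightarrow> nat) \<Rightarrow> int" where
  "Delta A a \<mu> = (THE m. \<exists>\<theta> d \<theta>' d'. homogeneous_basis (D_mod A a \<mu>) \<theta> d \<theta>' d' \<and>
                                     m = \<bar>int d - int d'\<bar>)"

definition Lam' :: "'h set \<Rightarrow> ('h \<Rightarrow> 'k::field poly poly) \<Rightarrow> ('h \<Rightarrow> nat) set" where
  "Lam' A a = {\<mu> \<in> Lam A. Delta A a \<mu> > 0}"

end

(* A derivation f d/dx + g d/dy is handled as the pair (f, g).  Raising the multiplicity of one line
   by 1 raises exactly one of the two exponents by 1, so the exponents add up to |mu| and Delta has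
   the parity of |mu|; this isolates the zeros of Delta.  Moreover Delta(mu) > 0 iff there is a
   nonzero homogeneous element of degree < |mu|/2, and the one of least degree, theta_mu, is then
   unique up to a scalar.

   For a covering pair mu, nu = mu + 1_H in Lambda', theta_nu is a scalar multiple of theta_mu or of
   alpha_H theta_mu.  Hence along a component all theta_mu agree up to products of the alpha_H, and
   comparing multiplicities of alpha_H in theta_mu(alpha_H) bounds |mu|, unless theta(alpha_H) = 0
   for some H.  The latter forces theta_mu to be a multiple of the product of the other
   alpha_H'^mu_H' times the derivation along H, that is mu in Lambda_H.  The sets Lambda_H are
   connected, and no edge of Lambda' leaves them because Delta vanishes where mu_H = |mu|/2. *)
theory Submission
  imports Defs
begin

section \<open>Homogeneous polynomials in two variables\<close>

text \<open>Why does exactly one exponent rise? Divide theta(alpha_H) and theta'(alpha_H) by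
  alpha_H^mu_H and evaluate the quotients at a point of H. The two values are never both 0, since
  D(A, mu) contains an element whose value on alpha_H has order exactly mu_H along H. If necessary,
  subtracting a multiple of the basis element of smaller degree from the other makes one value 0.
  That element survives and the other is multiplied by alpha_H. Started from d/dx, d/dy at mu = 0,
  this also proves freeness, on which the meaning of Delta rests. Evaluations take place only at one
  chosen point per line, so the field may be finite.\<close>

definition hcomp :: "nat \<Rightarrow> 'k::field poly poly \<Rightarrow> 'k poly poly" where
  "hcomp d p = (\<Sum>j\<le>d. monom (monom (coeff (coeff p j) (d - j)) (d - j)) j)"

lemma coeff_hcomp:
  "coeff (coeff (hcomp d p) j) i = (if i + j = d then coeff (coeff p j) i else 0)"
proof -
  have "coeff (coeff (hcomp d p) j) i =
    (\<Sum>l\<le>d. if l = j then (if d - l = i then coeff (coeff p l) i else 0) else 0)"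
    unfolding hcomp_def coeff_sum by (rule sum.cong) auto
  also have "\<dots> = (if i + j = d then coeff (coeff p j) i else 0)"
    by (auto simp: sum.delta')
  finally show ?thesis .
qed

lemma poly2_eqI: "(\<And>i j. coeff (coeff p j) i = coeff (coeff q j) i) \<Longrightarrow> p = q"
  by (simp add: poly_eq_iff)

lemma homogeneous_hcomp: "homogeneous d (hcomp d p)"
  by (simp add: homogeneous_def coeff_hcomp)

lemma hcomp_homogeneous: "homogeneous d p \<Longrightarrow> hcomp d p = p"
  by (rule poly2_eqI) (auto simp: coeff_hcomp homogeneous_def)

lemma hcomp_add: "hcomp d (p + q) = hcomp d p + hcomp d q"
  by (rule poly2_eqI) (auto simp: coeff_hcomp)

lemma coeff2_mult:
  "coeff (coeff (p * q) j) i =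
    (\<Sum>b\<le>j. \<Sum>a\<le>i. coeff (coeff p b) a * coeff (coeff q (j - b)) (i - a))"
  by (simp add: coeff_mult coeff_sum)

text \<open>A term of the convolution is nonzero only if its factor from \<open>h\<close> has total
  degree \<open>e\<close>, which fixes the degree of its factor from \<open>q\<close>. As
  \<open>q\<close> is arbitrary, relations with homogeneous factors can be cut down to a single
  degree.\<close>

lemma hcomp_mult:
  assumes "homogeneous e h"
  shows "hcomp d (q * h) = (if e \<le> d then hcomp (d - e) q * h else 0)"
proof (rule poly2_eqI)
  fix i j
  let ?c = "\<lambda>p j i. coeff (coeff p j) i"
  let ?t = "\<lambda>b a. ?c q b a * ?c h (j - b) (i - a)"
  have h: "?c h b a = 0" if "a + b \<noteq> e" for a b
    using assms that by (auto simp: homogeneous_def)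
  have t: "?t b a = (if e \<le> d \<and> a + b = d - e then ?t b a else 0)"
    if "i + j = d" "b \<le> j" "a \<le> i" for b a
  proof -
    have "(i - a) + (j - b) = e \<Longrightarrow> e \<le> d \<and> a + b = d - e" using that by linarith
    thus ?thesis using h[of "i - a" "j - b"] by auto
  qed
  have t': "a + b = d - e \<longrightarrow> ?t b a = 0" if "i + j \<noteq> d" "e \<le> d" "b \<le> j" "a \<le> i" for b a
    using that h[of "i - a" "j - b"] by auto
  have "(\<Sum>b\<le>j. \<Sum>a\<le>i. ?t b a) =
    (\<Sum>b\<le>j. \<Sum>a\<le>i. if e \<le> d \<and> a + b = d - e then ?t b a else 0)" if "i + j = d"
    by (intro sum.cong refl t that) auto
  moreover have "(\<Sum>b\<le>j. \<Sum>a\<le>i. if a + b = d - e then ?t b a else 0) = 0"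
    if "i + j \<noteq> d" "e \<le> d"
    using t'[OF that] by (intro sum.neutral ballI) auto
  ultimately show "?c (hcomp d (q * h)) j i = ?c (if e \<le> d then hcomp (d - e) q * h else 0) j i"
    by (cases "e \<le> d"; cases "i + j = d")
       (simp_all add: coeff_hcomp coeff2_mult if_distrib[of "\<lambda>x. x * _"] cong: if_cong)
qed

lemma homogeneous_mult: "homogeneous d p \<Longrightarrow> homogeneous e q \<Longrightarrow> homogeneous (d + e) (p * q)"
  using hcomp_mult[of e q "d + e" p] homogeneous_hcomp[of "d + e" "p * q"]
  by (simp add: hcomp_homogeneous)

lemma homogeneous_0 [simp]: "homogeneous d 0"
  and homogeneous_add: "homogeneous d p \<Longrightarrow> homogeneous d q \<Longrightarrow> homogeneous d (p + q)"
  and homogeneous_diff: "homogeneous d p \<Longrightarrow> homogeneous d q \<Longrightarrow> homogeneous d (p - q)"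
  unfolding homogeneous_def coeff_0 coeff_add coeff_diff
  by (metis, metis add.right_neutral, metis diff_zero)

lemma homogeneous_const: "homogeneous 0 [:[:c:]:]"
  by (auto simp: homogeneous_def coeff_pCons split: nat.splits)

lemma homogeneous_linear_form: "homogeneous 1 [:[:0, a:], [:b:]:]"
  by (auto simp: homogeneous_def coeff_pCons split: nat.splits)

lemma homogeneous_0_const:
  assumes "homogeneous 0 p"
  obtains c where "p = [:[:c:]:]"
proof
  show "p = [:[:coeff (coeff p 0) 0:]:]"
    using assms by (intro poly2_eqI) (auto simp: homogeneous_def coeff_pCons split: nat.splits)
qed

lemma homogeneous_const_mult: "homogeneous d p \<Longrightarrow> homogeneous d ([:[:c:]:] * p)"
  using homogeneous_mult[OF homogeneous_const[of c], of d p] by simp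

lemma homogeneous_1: "homogeneous 0 1"
  using homogeneous_const[of 1] by (simp add: one_pCons)

lemma homogeneous_power: "homogeneous d p \<Longrightarrow> homogeneous (d * n) (p ^ n)"
  by (induction n) (auto simp: homogeneous_1 intro: homogeneous_mult)

lemma homogeneous_prod:
  "(\<And>x. x \<in> B \<Longrightarrow> homogeneous (d x) (p x)) \<Longrightarrow> homogeneous (sum d B) (prod p B)"
  by (induction B rule: infinite_finite_induct) (auto simp: homogeneous_1 intro: homogeneous_mult)

text \<open>The quotient may be replaced by its component of degree \<open>d - e\<close>. The bound
  \<open>e \<le> d\<close> for nonzero \<open>p\<close> is the source of later degree estimates;
  zero has every degree and forms its own case.\<close>

lemma homogeneous_dvdE:
  assumes "h dvd p" "homogeneous e h" "homogeneous d p"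
  obtains "p = 0" | q where "e \<le> d" "homogeneous (d - e) q" "p = q * h"
proof -
  obtain q where "p = q * h" using assms(1) by (auto simp: dvd_def mult.commute)
  hence "p = (if e \<le> d then hcomp (d - e) q * h else 0)"
    using hcomp_mult[OF assms(2), of d q] hcomp_homogeneous[OF assms(3)] by simp
  thus ?thesis using that homogeneous_hcomp by (auto split: if_splits)
qed

text \<open>The expansion holds for all large \<open>M\<close>, so that two polynomials can be
  expanded up to a common bound.\<close>

lemma sum_hcomp: obtains N where "\<And>M. N \<le> M \<Longrightarrow> p = (\<Sum>d\<le>M. hcomp d p)"
proof -
  define N where "N = degree p + (\<Sum>j\<le>degree p. degree (coeff p j))"
  have N: "i + j \<le> N" if "coeff (coeff p j) i \<noteq> 0" for i j
  proof -
    have j: "j \<le> degree p" using that by (metis coeff_0 le_degree)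
    have "i \<le> degree (coeff p j)" using that by (rule le_degree)
    also have "\<dots> \<le> (\<Sum>j\<le>degree p. degree (coeff p j))"
      using j by (intro member_le_sum) auto
    finally show ?thesis using j by (simp add: N_def)
  qed
  have "p = (\<Sum>d\<le>M. hcomp d p)" if M: "N \<le> M" for M
  proof (rule poly2_eqI)
    fix i j
    have "coeff (coeff (\<Sum>d\<le>M. hcomp d p) j) i = (\<Sum>d\<le>M. if i + j = d then coeff (coeff p j) i else 0)"
      by (simp add: coeff_sum coeff_hcomp)
    also have "\<dots> = coeff (coeff p j) i"
    proof -
      have "coeff (coeff p j) i \<noteq> 0 \<longrightarrow> i + j \<le> M" using N M by (meson order_trans)
      thus ?thesis by (subst sum.delta') auto
    qed
    finally show "coeff (coeff p j) i = coeff (coeff (\<Sum>d\<le>M. hcomp d p) j) i" by (rule sym)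
  qed
  thus ?thesis by (rule that)
qed

section \<open>Evaluation at a point and divisibility by a linear form\<close>

definition ev :: "'k::field poly poly \<Rightarrow> 'k \<Rightarrow> 'k \<Rightarrow> 'k" where
  "ev p u v = poly (poly p [:v:]) u"

lemma ev_simps [simp]:
  "ev 0 u v = 0" "ev 1 u v = 1" "ev (p + q) u v = ev p u v + ev q u v"
  "ev (p - q) u v = ev p u v - ev q u v" "ev (p * q) u v = ev p u v * ev q u v"
  "ev (p ^ n) u v = ev p u v ^ n" "ev [:[:c:]:] u v = c"
  "ev [:[:0, a:], [:b:]:] u v = a * u + b * v"
  by (simp_all add: ev_def mult.commute)

lemma ev_prod: "ev (prod p B) u v = (\<Prod>x\<in>B. ev (p x) u v)"
  by (induction B rule: infinite_finite_induct) auto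

text \<open>The point \<open>(- b, a)\<close> spans the zero line of the form. Homogeneity makes one
  value there decide divisibility, over any field.\<close>

lemma linear_form_dvd_iff:
  assumes p: "homogeneous d p" and ab: "a \<noteq> 0 \<or> b \<noteq> 0"
  shows "[:[:0, a:], [:b:]:] dvd p \<longleftrightarrow> ev p (- b) a = 0"
proof
  assume "[:[:0, a:], [:b:]:] dvd p"
  then obtain k where "p = [:[:0, a:], [:b:]:] * k" by (rule dvdE)
  thus "ev p (- b) a = 0" by (simp only: ev_simps) simp
next
  assume ev: "ev p (- b) a = 0"
  define c where "c j = coeff (coeff p j) (d - j)" for j
  have p_eq: "p = (\<Sum>j\<le>d. monom (monom (c j) (d - j)) j)"
    using hcomp_homogeneous[OF p] by (simp add: hcomp_def c_def)
  have ev_eq: "ev p u v = (\<Sum>j\<le>d. c j * u ^ (d - j) * v ^ j)" for u v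
    unfolding ev_def
    by (subst p_eq) (simp add: poly_sum poly_monom poly_const_pow mult_ac)
  show "[:[:0, a:], [:b:]:] dvd p"
  proof (cases "b = 0")
    case True
    with ab have a: "a \<noteq> 0" by simp
    \<comment> \<open>The form is \<open>a x\<close>; at \<open>(0, a)\<close> only the monomial
      \<open>y^d\<close> survives, so its coefficient is 0 and every other monomial contains
      \<open>x\<close>.\<close>
    have "ev p 0 a = (\<Sum>j\<le>d. if j = d then c d * a ^ d else 0)"
      unfolding ev_eq by (rule sum.cong) (auto simp: power_0_left)
    hence cd: "c d = 0" using ev True a by simp
    have "[:[:0, a:]:] dvd monom (monom (c j) (d - j)) j" if "j \<le> d" for j
    proof (cases "j = d")
      case False
      with that obtain m where m: "d - j = Suc m" by (cases "d - j") auto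
      have "monom (monom (c j) (d - j)) j = [:[:0, a:]:] * monom (monom (c j / a) m) j"
        using a by (simp add: m smult_monom monom_Suc mult.commute)
      thus ?thesis by (rule dvdI)
    qed (simp add: cd)
    hence "[:[:0, a:]:] dvd p" by (subst p_eq) (auto intro: dvd_sum)
    thus ?thesis using True by simp
  next
    case False
    \<comment> \<open>The form is \<open>b (y - e x)\<close>, with zero line spanned by
      \<open>(1, e)\<close>; substituting \<open>y = e x\<close> turns \<open>p\<close> into a
      constant times \<open>x^d\<close>, and the factor theorem in \<open>y\<close> applies.\<close>
    define e where "e = - a / b"
    have a: "a = e * - b" using False by (simp add: e_def)
    have "ev p (- b) a = (- b) ^ d * (\<Sum>j\<le>d. c j * e ^ j)"
      unfolding ev_eq sum_distrib_left
    proof (rule sum.cong, simp)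
      fix j assume "j \<in> {..d}"
      hence "(- b) ^ d = (- b) ^ (d - j) * (- b) ^ j" by (simp flip: power_add)
      thus "c j * (- b) ^ (d - j) * a ^ j = (- b) ^ d * (c j * e ^ j)"
        by (simp only: a power_mult_distrib mult_ac)
    qed
    hence s: "(\<Sum>j\<le>d. c j * e ^ j) = 0" using ev False by simp
    have e_pow: "[:0, e:] ^ j = monom (e ^ j) j" for j
    proof -
      have "[:0, e:] = monom e 1" by (simp add: monom_Suc monom_0)
      thus ?thesis by (simp add: monom_power)
    qed
    have "poly p [:0, e:] = (\<Sum>j\<le>d. monom (c j * e ^ j) d)"
      by (subst p_eq) (simp add: poly_sum poly_monom e_pow mult_monom)
    also have "\<dots> = monom (\<Sum>j\<le>d. c j * e ^ j) d"
      by (simp add: poly_eq_iff coeff_sum)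
    finally have "[:- [:0, e:], 1:] dvd p" using s by (simp add: poly_eq_0_iff_dvd)
    hence "[:[:b:]:] * [:- [:0, e:], 1:] dvd [:[:b:]:] * ([:[:1 / b:]:] * p)"
      by (intro mult_dvd_mono dvd_refl dvd_mult)
    moreover have "[:[:b:]:] * [:- [:0, e:], 1:] = [:[:0, a:], [:b:]:]"
      using False by (simp add: e_def)
    moreover have "[:[:b:]:] * ([:[:1 / b:]:] * p) = p"
      using False by (simp flip: one_pCons)
    ultimately show ?thesis by simp
  qed
qed

section \<open>Bases of the modules of multiderivations\<close>

text \<open>\<open>V\<close> is reduced to coordinates: \<open>ca H\<close> and \<open>cb H\<close>
  are the values of the form of \<open>H\<close> on the two basis vectors, and
  \<open>distinct\<close> says that the determinant of two forms is nonzero.\<close>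

locale line_arrangement =
  fixes A :: "'h set" and ca cb :: "'h \<Rightarrow> 'k::field"
  assumes finite_A: "finite A"
    and nonzero: "H \<in> A \<Longrightarrow> ca H \<noteq> 0 \<or> cb H \<noteq> 0"
    and distinct: "H \<in> A \<Longrightarrow> H' \<in> A \<Longrightarrow> H \<noteq> H' \<Longrightarrow> ca H * cb H' \<noteq> cb H * ca H'"
begin

definition lf :: "'h \<Rightarrow> 'k poly poly" where
  "lf H = [:[:0, ca H:], [:cb H:]:]"

text \<open>The pair \<open>(f, g)\<close> stands for \<open>f \<partial>\<^sub>x + g \<partial>\<^sub>y\<close>, whose value on \<open>\<alpha>\<^sub>H\<close> is \<open>val H f g\<close>.\<close>

definition val :: "'h \<Rightarrow> 'k poly poly \<Rightarrow> 'k poly poly \<Rightarrow> 'k poly poly" where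
  "val H f g = [:[:ca H:]:] * f + [:[:cb H:]:] * g"

text \<open>
  \<open>(- cb H, ca H)\<close> spans the line \<open>H\<close>, so for homogeneous \<open>p\<close> the scalar \<open>ev_on H p\<close> decides
  divisibility by \<open>\<alpha>\<^sub>H\<close>; this replaces unique factorization throughout.
\<close>

definition ev_on :: "'h \<Rightarrow> 'k poly poly \<Rightarrow> 'k" where
  "ev_on H p = ev p (- cb H) (ca H)"

definition inD :: "('h \<Rightarrow> nat) \<Rightarrow> 'k poly poly \<Rightarrow> 'k poly poly \<Rightarrow> bool" where
  "inD \<mu> f g \<longleftrightarrow> (\<forall>H\<in>A. lf H ^ \<mu> H dvd val H f g)"

definition hinD :: "('h \<Rightarrow> nat) \<Rightarrow> nat \<Rightarrow> 'k poly poly \<Rightarrow> 'k poly poly \<Rightarrow> bool" where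
  "hinD \<mu> d f g \<longleftrightarrow> homogeneous d f \<and> homogeneous d g \<and> inD \<mu> f g"

text \<open>Spanning is stated as one inclusion; the other follows from the two memberships by
  \<open>inD_add\<close> and \<open>inD_mult\<close>.\<close>

definition hbasis where
  "hbasis \<mu> f g d f' g' d' \<longleftrightarrow> hinD \<mu> d f g \<and> hinD \<mu> d' f' g' \<and>
     (\<forall>p q. inD \<mu> p q \<longrightarrow> (\<exists>a b. p = a * f + b * f' \<and> q = a * g + b * g')) \<and>
     (\<forall>a b. a * f + b * f' = 0 \<and> a * g + b * g' = 0 \<longrightarrow> a = 0 \<and> b = 0)"

lemma ev_on_simps [simp]:
  "ev_on H 0 = 0" "ev_on H 1 = 1" "ev_on H (p + q) = ev_on H p + ev_on H q" "ev_on H (p - q) = ev_on H p - ev_on H q"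
  "ev_on H (p * q) = ev_on H p * ev_on H q" "ev_on H (p ^ n) = ev_on H p ^ n" "ev_on H [:[:c:]:] = c"
  "ev_on H (lf H) = 0"
  by (simp_all add: ev_on_def lf_def)

lemma ev_on_prod: "ev_on H (prod p B) = (\<Prod>x\<in>B. ev_on H (p x))"
  by (simp add: ev_on_def ev_prod)

lemma ev_on_lf: "H \<in> A \<Longrightarrow> H' \<in> A \<Longrightarrow> H \<noteq> H' \<Longrightarrow> ev_on H (lf H') \<noteq> 0"
  using distinct[of H H'] by (auto simp: ev_on_def lf_def mult.commute)

lemma lf_nonzero: "H \<in> A \<Longrightarrow> lf H \<noteq> 0"
  using nonzero[of H] by (auto simp: lf_def)

lemma homogeneous_lf: "homogeneous 1 (lf H)"
  unfolding lf_def by (rule homogeneous_linear_form)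

lemma homogeneous_lf_power: "homogeneous n (lf H ^ n)"
  using homogeneous_power[OF homogeneous_lf[of H], of n] by simp

lemma lf_dvd_iff: "H \<in> A \<Longrightarrow> homogeneous d p \<Longrightarrow> lf H dvd p \<longleftrightarrow> ev_on H p = 0"
  unfolding lf_def ev_on_def by (rule linear_form_dvd_iff) (use nonzero in auto)

lemma lf_dvd_imp: "lf H dvd p \<Longrightarrow> ev_on H p = 0"
  by (auto elim!: dvdE)

text \<open>As \<open>q\<close> does not vanish on \<open>H\<close>, \<open>p\<close> does, so one
  form splits off \<open>p\<close>; the quotient is again homogeneous and the step repeats.\<close>

lemma lf_power_dvd_cancel:
  assumes "H \<in> A" "homogeneous d p" "ev_on H q \<noteq> 0" "lf H ^ m dvd q * p"
  shows "lf H ^ m dvd p"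
  using assms(2,4)
proof (induction m arbitrary: d p)
  case (Suc m)
  have "lf H dvd q * p" using Suc.prems(2) by (auto intro: dvd_trans[rotated])
  hence "ev_on H p = 0" using lf_dvd_imp[of H "q * p"] assms(3) by simp
  hence "lf H dvd p" using lf_dvd_iff[OF assms(1) Suc.prems(1)] by simp
  thus ?case
  proof (rule homogeneous_dvdE[OF _ homogeneous_lf Suc.prems(1)])
    fix r assume r: "homogeneous (d - 1) r" "p = r * lf H"
    have "lf H * lf H ^ m dvd lf H * (q * r)" using Suc.prems(2) r(2) by (simp add: mult_ac)
    hence "lf H ^ m dvd q * r" using lf_nonzero[OF assms(1)] by simp
    from Suc.IH[OF r(1) this] show ?thesis by (simp add: r(2) mult_dvd_mono mult.commute)
  qed simp
qed simp

lemma homogeneous_val: "homogeneous d f \<Longrightarrow> homogeneous d g \<Longrightarrow> homogeneous d (val H f g)"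
  unfolding val_def by (intro homogeneous_add homogeneous_const_mult)

lemma val_add: "val H (f + f') (g + g') = val H f g + val H f' g'"
  and val_diff: "val H (f - f') (g - g') = val H f g - val H f' g'"
  and val_mult: "val H (r * f) (r * g) = r * val H f g"
  unfolding val_def by algebra+

lemma hcomp_val: "hcomp d (val H f g) = val H (hcomp d f) (hcomp d g)"
  using hcomp_mult[OF homogeneous_const, of d f "ca H"] hcomp_mult[OF homogeneous_const, of d g "cb H"]
  by (simp only: val_def hcomp_add mult.commute[of "[:[:_:]:]"]) simp

lemma inD_hcomp: "inD \<mu> f g \<Longrightarrow> inD \<mu> (hcomp d f) (hcomp d g)"
  unfolding inD_def hcomp_val[symmetric]
proof (intro ballI, elim ballE)
  fix H assume "lf H ^ \<mu> H dvd val H f g"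
  then obtain q where "val H f g = lf H ^ \<mu> H * q" by (rule dvdE)
  hence "val H f g = q * lf H ^ \<mu> H" by (simp only: mult.commute)
  thus "lf H ^ \<mu> H dvd hcomp d (val H f g)"
    by (simp add: hcomp_mult[OF homogeneous_lf_power])
qed auto

lemma inD_add: "inD \<mu> f g \<Longrightarrow> inD \<mu> f' g' \<Longrightarrow> inD \<mu> (f + f') (g + g')"
  and inD_diff: "inD \<mu> f g \<Longrightarrow> inD \<mu> f' g' \<Longrightarrow> inD \<mu> (f - f') (g - g')"
  and inD_mult: "inD \<mu> f g \<Longrightarrow> inD \<mu> (r * f) (r * g)"
  by (auto simp: inD_def val_add val_diff val_mult)

lemma inD_mono: "inD \<nu> f g \<Longrightarrow> (\<And>H. H \<in> A \<Longrightarrow> \<mu> H \<le> \<nu> H) \<Longrightarrow> inD \<mu> f g"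
  unfolding inD_def by (meson le_imp_power_dvd dvd_trans)

lemma inD_lf_mult: "inD \<mu> f g \<Longrightarrow> inD (\<mu>(H := Suc (\<mu> H))) (lf H * f) (lf H * g)"
  by (auto simp: inD_def val_mult mult_dvd_mono)

lemma hinD_lf_mult: "hinD \<mu> d f g \<Longrightarrow> hinD (\<mu>(H := Suc (\<mu> H))) (Suc d) (lf H * f) (lf H * g)"
  using homogeneous_mult[OF homogeneous_lf] inD_lf_mult by (simp add: hinD_def)

lemma hbasis_hinD:
  assumes "hbasis \<mu> f g d f' g' d'" shows "hinD \<mu> d f g" "hinD \<mu> d' f' g'"
  using assms unfolding hbasis_def by (rule conjunct1, rule conjunct1[OF conjunct2])

lemma hinD_homogeneous:
  assumes "hinD \<mu> d f g" shows "homogeneous d f" "homogeneous d g" "inD \<mu> f g"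
  using assms by (simp_all add: hinD_def)

lemma hbasis_swap:
  assumes "hbasis \<mu> f g d f' g' d'" shows "hbasis \<mu> f' g' d' f g d"
proof -
  have "\<exists>a b. p = a * f' + b * f \<and> q = a * g' + b * g" if pq: "inD \<mu> p q" for p q
  proof -
    obtain a b where "p = a * f + b * f'" "q = a * g + b * g'"
      using assms pq unfolding hbasis_def by blast
    hence "p = b * f' + a * f \<and> q = b * g' + a * g" by (simp add: add.commute)
    thus ?thesis by blast
  qed
  moreover have "a = 0 \<and> b = 0" if ab: "a * f' + b * f = 0 \<and> a * g' + b * g = 0" for a b
  proof -
    have "b * f + a * f' = 0 \<and> b * g + a * g' = 0" using ab by (simp add: add.commute)
    thus ?thesis using assms unfolding hbasis_def by blast
  qed
  ultimately show ?thesis using hbasis_hinD[OF assms] unfolding hbasis_def by blast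
qed

text \<open>Taking parts of degree \<open>e\<close> on both sides makes the coefficients
  homogeneous, and kills the coefficient of a basis element of degree above
  \<open>e\<close>.\<close>

lemma hom_span:
  assumes B: "hbasis \<mu> f g d f' g' d'" and h: "hinD \<mu> e p q"
  obtains a b where "a = 0 \<or> d \<le> e \<and> homogeneous (e - d) a"
    "b = 0 \<or> d' \<le> e \<and> homogeneous (e - d') b"
    "p = a * f + b * f'" "q = a * g + b * g'"
proof -
  from B h obtain a b where ab: "p = a * f + b * f'" "q = a * g + b * g'"
    unfolding hbasis_def hinD_def by blast
  have hom: "homogeneous d f" "homogeneous d g" "homogeneous d' f'" "homogeneous d' g'"
    "homogeneous e p" "homogeneous e q"
    using hbasis_hinD[OF B] h by (simp_all add: hinD_def)
  define a' where "a' = (if d \<le> e then hcomp (e - d) a else 0)"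
  define b' where "b' = (if d' \<le> e then hcomp (e - d') b else 0)"
  show ?thesis
  proof
    show "a' = 0 \<or> d \<le> e \<and> homogeneous (e - d) a'" "b' = 0 \<or> d' \<le> e \<and> homogeneous (e - d') b'"
      by (auto simp: a'_def b'_def homogeneous_hcomp)
    have "p = hcomp e (a * f + b * f')" "q = hcomp e (a * g + b * g')"
      using ab hcomp_homogeneous hom(5,6) by metis+
    thus "p = a' * f + b' * f'" "q = a' * g + b' * g'"
      unfolding hcomp_add hcomp_mult[OF hom(1)] hcomp_mult[OF hom(2)]
        hcomp_mult[OF hom(3)] hcomp_mult[OF hom(4)] a'_def b'_def
      by (simp_all split: if_splits)
  qed
qed

text \<open>Membership passes to homogeneous components, so spanning may be tested on these and the
  coefficients added up.\<close>

lemma hbasisI: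
  assumes "hinD \<mu> d f g" "hinD \<mu> d' f' g'"
    and span: "\<And>e p q. hinD \<mu> e p q \<Longrightarrow> \<exists>a b. p = a * f + b * f' \<and> q = a * g + b * g'"
    and "\<And>a b. a * f + b * f' = 0 \<Longrightarrow> a * g + b * g' = 0 \<Longrightarrow> a = 0 \<and> b = 0"
  shows "hbasis \<mu> f g d f' g' d'"
  unfolding hbasis_def
proof (intro conjI allI impI)
  fix p q assume pq: "inD \<mu> p q"
  have "\<forall>e. \<exists>a b. hcomp e p = a * f + b * f' \<and> hcomp e q = a * g + b * g'"
  proof
    fix e
    have "hinD \<mu> e (hcomp e p) (hcomp e q)"
      unfolding hinD_def by (intro conjI homogeneous_hcomp inD_hcomp[OF pq])
    thus "\<exists>a b. hcomp e p = a * f + b * f' \<and> hcomp e q = a * g + b * g'" by (rule span)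
  qed
  then obtain a b where ab: "\<And>e. hcomp e p = a e * f + b e * f'" "\<And>e. hcomp e q = a e * g + b e * g'"
    by metis
  obtain N where N: "\<And>M. N \<le> M \<Longrightarrow> p = (\<Sum>d\<le>M. hcomp d p)" by (rule sum_hcomp) blast
  obtain N' where N': "\<And>M. N' \<le> M \<Longrightarrow> q = (\<Sum>d\<le>M. hcomp d q)" by (rule sum_hcomp) blast
  have "p = (\<Sum>d\<le>N + N'. a d * f + b d * f')" "q = (\<Sum>d\<le>N + N'. a d * g + b d * g')"
    using N[of "N + N'"] N'[of "N + N'"] ab by simp_all
  thus "\<exists>a b. p = a * f + b * f' \<and> q = a * g + b * g'"
    unfolding sum.distrib sum_distrib_right[symmetric] by blast
qed (use assms in blast)+

section \<open>Raising one multiplicity by one\<close>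

lemma hbasis_change:
  assumes B: "hbasis \<mu> f g d f' g' d'" and q: "homogeneous (d' - d) q" "d \<le> d'"
  shows "hbasis \<mu> f g d (f' - q * f) (g' - q * g) d'"
proof -
  have hf: "homogeneous d' (q * f)" "homogeneous d' (q * g)"
    using hbasis_hinD(1)[OF B, THEN hinD_homogeneous(1)] hbasis_hinD(1)[OF B, THEN hinD_homogeneous(2)]
      homogeneous_mult[OF q(1)] q(2) by (metis le_add_diff_inverse2)+
  show ?thesis unfolding hbasis_def
  proof (intro conjI allI impI)
    show "hinD \<mu> d f g" "hinD \<mu> d' (f' - q * f) (g' - q * g)"
      using hbasis_hinD[OF B] hf by (simp_all add: hinD_def homogeneous_diff inD_diff inD_mult)
  next
    fix x y assume "inD \<mu> x y"
    then obtain a b where "x = a * f + b * f'" "y = a * g + b * g'"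
      using B unfolding hbasis_def by blast
    hence "x = (a + b * q) * f + b * (f' - q * f) \<and> y = (a + b * q) * g + b * (g' - q * g)"
      by (simp add: algebra_simps)
    thus "\<exists>a b. x = a * f + b * (f' - q * f) \<and> y = a * g + b * (g' - q * g)" by blast
  next
    fix a b
    assume "a * f + b * (f' - q * f) = 0 \<and> a * g + b * (g' - q * g) = 0"
    hence "(a - b * q) * f + b * f' = 0 \<and> (a - b * q) * g + b * g' = 0"
      by (simp add: algebra_simps)
    hence "a - b * q = 0 \<and> b = 0" using B unfolding hbasis_def by blast
    thus "a = 0" "b = 0" by auto
  qed
qed

lemma inD_Suc_iff:
  assumes "H \<in> A" "inD \<mu> f g" "val H f g = p * lf H ^ \<mu> H"
  shows "inD (\<mu>(H := Suc (\<mu> H))) f g \<longleftrightarrow> lf H dvd p"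
  using assms lf_nonzero[of H] by (auto simp: inD_def)

text \<open>Once the quotient \<open>p\<close> vanishes on \<open>H\<close> and \<open>p'\<close>
  does not, a combination with coefficients \<open>a\<close>, \<open>b\<close> lies in the smaller
  module only if \<open>b\<close> vanishes on \<open>H\<close>, that is, only if \<open>lf H\<close>
  divides \<open>b\<close>.\<close>

lemma hbasis_Suc_aux:
  assumes H: "H \<in> A" and B: "hbasis \<mu> f g d f' g' d'"
    and f: "val H f g = p * lf H ^ \<mu> H" "homogeneous e p" "ev_on H p = 0"
    and f': "val H f' g' = p' * lf H ^ \<mu> H" "ev_on H p' \<noteq> 0"
  shows "hbasis (\<mu>(H := Suc (\<mu> H))) f g d (lf H * f') (lf H * g') (Suc d')"
proof (rule hbasisI)
  have D: "hinD \<mu> d f g" "hinD \<mu> d' f' g'" using hbasis_hinD[OF B] .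
  show "hinD (\<mu>(H := Suc (\<mu> H))) d f g"
    using D(1) inD_Suc_iff[of H \<mu> f g p] H f(1) lf_dvd_iff[OF H f(2)] f(3) by (auto simp: hinD_def)
  show "hinD (\<mu>(H := Suc (\<mu> H))) (Suc d') (lf H * f') (lf H * g')"
    by (rule hinD_lf_mult[OF D(2)])
next
  fix a b assume "a * f + b * (lf H * f') = 0" "a * g + b * (lf H * g') = 0"
  hence "a * f + (b * lf H) * f' = 0 \<and> a * g + (b * lf H) * g' = 0" by (simp add: mult_ac)
  hence "a = 0 \<and> b * lf H = 0" using B unfolding hbasis_def by blast
  thus "a = 0 \<and> b = 0" using lf_nonzero[OF H] by simp
next
  fix k x y assume xy: "hinD (\<mu>(H := Suc (\<mu> H))) k x y"
  hence "hinD \<mu> k x y" by (auto simp: hinD_def elim!: inD_mono)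
  with B obtain a b where ab: "b = 0 \<or> d' \<le> k \<and> homogeneous (k - d') b"
    "x = a * f + b * f'" "y = a * g + b * g'" by (rule hom_span)
  have v: "val H x y = (a * p + b * p') * lf H ^ \<mu> H"
    by (simp add: ab(2,3) val_add val_mult f(1) f'(1) algebra_simps)
  have "lf H dvd a * p + b * p'"
    using xy inD_Suc_iff[of H \<mu> x y "a * p + b * p'"] H v \<open>hinD \<mu> k x y\<close> by (auto simp: hinD_def)
  hence "ev_on H b = 0" using lf_dvd_imp f(3) f'(2) by fastforce
  hence "lf H dvd b" using ab(1) lf_dvd_iff[OF H] by auto
  then obtain c where "b = lf H * c" by (rule dvdE)
  hence "x = a * f + c * (lf H * f') \<and> y = a * g + c * (lf H * g')"
    by (simp add: ab(2,3) mult_ac)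
  thus "\<exists>a b. x = a * f + b * (lf H * f') \<and> y = a * g + b * (lf H * g')" by blast
qed

lemma val_quotient:
  assumes "H \<in> A" "hinD \<mu> d f g"
  obtains e p where "val H f g = p * lf H ^ \<mu> H" "homogeneous e p"
proof (rule homogeneous_dvdE)
  show "lf H ^ \<mu> H dvd val H f g" "homogeneous d (val H f g)"
    using assms by (auto simp: hinD_def inD_def intro: homogeneous_val)
qed (use that[of 0 0] that homogeneous_lf_power in auto)

text \<open>The module contains an element whose value on \<open>\<alpha>_H\<close> is
  \<open>Q * lf H ^ \<mu> H\<close> with \<open>Q\<close> nonzero on \<open>H\<close>. If both
  quotients vanished on \<open>H\<close>, so would the quotient of every element of the
  span.\<close>

lemma hbasis_not_both_vanishing:
  assumes H: "H \<in> A" and B: "hbasis \<mu> f g d f' g' d'"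
    and f: "val H f g = p * lf H ^ \<mu> H" and f': "val H f' g' = p' * lf H ^ \<mu> H"
  shows "ev_on H p \<noteq> 0 \<or> ev_on H p' \<noteq> 0"
proof -
  define Q where "Q = (\<Prod>H'\<in>A - {H}. lf H' ^ \<mu> H')"
  have Q: "(\<Prod>H'\<in>A. lf H' ^ \<mu> H') = Q * lf H ^ \<mu> H"
    unfolding Q_def using prod.remove[OF finite_A H] by (simp add: mult.commute)
  \<comment> \<open>A constant derivation with value 1 on \<open>\<alpha>_H\<close>.\<close>
  obtain u v where uv: "ca H * u + cb H * v = 1"
    using nonzero[OF H] by (metis add.left_neutral add.right_neutral mult_zero_right right_inverse)
  have "inD \<mu> (Q * lf H ^ \<mu> H * [:[:u:]:]) (Q * lf H ^ \<mu> H * [:[:v:]:])"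
    unfolding inD_def val_mult Q[symmetric]
    using finite_A by (auto intro!: dvd_mult2 dvd_prodI)
  then obtain a b where "Q * lf H ^ \<mu> H * [:[:u:]:] = a * f + b * f'"
    "Q * lf H ^ \<mu> H * [:[:v:]:] = a * g + b * g'"
    using B unfolding hbasis_def by blast
  hence "val H (Q * lf H ^ \<mu> H * [:[:u:]:]) (Q * lf H ^ \<mu> H * [:[:v:]:]) = (a * p + b * p') * lf H ^ \<mu> H"
    by (simp add: val_add val_mult f f' algebra_simps)
  moreover have "val H [:[:u:]:] [:[:v:]:] = 1"
    using uv by (simp add: val_def one_pCons)
  ultimately have "Q * lf H ^ \<mu> H = (a * p + b * p') * lf H ^ \<mu> H"
    by (simp only: val_mult mult_1_right)
  hence "Q = a * p + b * p'" using lf_nonzero[OF H] by simp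
  moreover have "ev_on H Q \<noteq> 0"
    unfolding Q_def ev_on_prod using finite_A H ev_on_lf[OF H] by auto
  ultimately show ?thesis by auto
qed

lemma ex_homogeneous_ev_on:
  assumes "H \<in> A" obtains q where "homogeneous n q" "ev_on H q = c"
proof -
  obtain l where l: "homogeneous 1 l" "ev_on H l \<noteq> 0"
    using nonzero[OF assms] homogeneous_linear_form[of 1 0] homogeneous_linear_form[of 0 1]
    unfolding ev_on_def using ev_simps(8)[of 1 0] ev_simps(8)[of 0 1]
    by (metis add.left_neutral add.right_neutral mult_1 mult_zero_left neg_equal_0_iff_equal)
  show ?thesis
  proof
    show "homogeneous n ([:[:c / ev_on H l ^ n:]:] * l ^ n)"
      using homogeneous_power[OF l(1), of n] by (intro homogeneous_const_mult) simp
    show "ev_on H ([:[:c / ev_on H l ^ n:]:] * l ^ n) = c" 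
      unfolding ev_on_simps using l(2) by simp
  qed
qed

lemma hbasis_Suc:
  assumes H: "H \<in> A" and B: "hbasis \<mu> f g d f' g' d'" and le: "d \<le> d'"
  shows "\<exists>f1 g1 d1 f2 g2 d2. hbasis (\<mu>(H := Suc (\<mu> H))) f1 g1 d1 f2 g2 d2 \<and> d1 + d2 = Suc (d + d')"
proof -
  have D: "hinD \<mu> d f g" "hinD \<mu> d' f' g'" using hbasis_hinD[OF B] .
  obtain e p where p: "val H f g = p * lf H ^ \<mu> H" "homogeneous e p"
    using val_quotient[OF H D(1)] .
  obtain e' p' where p': "val H f' g' = p' * lf H ^ \<mu> H" "homogeneous e' p'"
    using val_quotient[OF H D(2)] .
  show ?thesis
  proof (cases "ev_on H p = 0")
    case True
    with hbasis_not_both_vanishing[OF H B p(1) p'(1)] have "ev_on H p' \<noteq> 0" by simp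
    from hbasis_Suc_aux[OF H B p True p'(1) this] show ?thesis
      by (metis add_Suc_right)
  next
    case False
    \<comment> \<open>The value of \<open>q\<close> on \<open>H\<close> makes the corrected second
      element vanish there to higher order; its degree keeps the correction homogeneous, which is
      where \<open>d \<le> d'\<close> enters. The first element then receives the factor
      \<open>lf H\<close>.\<close>
    obtain q where q: "homogeneous (d' - d) q" "ev_on H q = ev_on H p' / ev_on H p"
      using ex_homogeneous_ev_on[OF H] .
    have B': "hbasis \<mu> f g d (f' - q * f) (g' - q * g) d'"
      by (rule hbasis_change[OF B q(1) le])
    then obtain e2 p2 where p2: "val H (f' - q * f) (g' - q * g) = p2 * lf H ^ \<mu> H" "homogeneous e2 p2"
      using val_quotient[OF H] unfolding hbasis_def by metis
    have "p2 * lf H ^ \<mu> H = (p' - q * p) * lf H ^ \<mu> H"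
      unfolding p2(1)[symmetric] val_diff val_mult p(1) p'(1) by (simp add: algebra_simps)
    hence "p2 = p' - q * p" using lf_nonzero[OF H] by simp
    hence "ev_on H p2 = 0" using False q(2) by simp
    from hbasis_Suc_aux[OF H hbasis_swap[OF B'] p2 this p(1) False] show ?thesis
      by (metis add_Suc_right add.commute)
  qed
qed

lemma hbasis_exists:
  "\<exists>f g d f' g' d'. hbasis \<mu> f g d f' g' d' \<and> d \<le> d' \<and> d + d' = msize A \<mu>"
proof (induction "msize A \<mu>" arbitrary: \<mu>)
  case 0
  hence "\<forall>H\<in>A. \<mu> H = 0" using finite_A by (simp add: msize_def)
  hence "hbasis \<mu> 1 0 0 0 1 0" 
    by (simp add: hbasis_def hinD_def inD_def homogeneous_1)
  with 0 show ?case by (metis add.right_neutral order_refl)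
next
  case (Suc n)
  then obtain H where H: "H \<in> A" "\<mu> H > 0"
    by (metis msize_def bot_nat_0.not_eq_extremum nat.distinct(1) sum.neutral)
  define \<nu> where "\<nu> = \<mu>(H := \<mu> H - 1)"
  have \<mu>: "\<mu> = \<nu>(H := Suc (\<nu> H))" using H(2) by (auto simp: \<nu>_def)
  have "msize A \<mu> = Suc (msize A \<nu>)"
    unfolding msize_def sum.remove[OF finite_A H(1)] \<nu>_def using H(2) by simp
  hence n: "n = msize A \<nu>" using Suc.hyps(2) by simp
  from Suc.hyps(1)[OF n] obtain f g d f' g' d' where B: "hbasis \<nu> f g d f' g' d'" "d \<le> d'" "d + d' = n"
    unfolding n by blast
  from hbasis_Suc[OF H(1) B(1,2)] obtain f1 g1 d1 f2 g2 d2
    where B': "hbasis \<mu> f1 g1 d1 f2 g2 d2" "d1 + d2 = msize A \<mu>"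
    unfolding \<mu>[symmetric] B(3) Suc.hyps(2) by blast
  show ?case
  proof (cases "d1 \<le> d2")
    case True with B' show ?thesis by blast
  next
    case False with B'(2) hbasis_swap[OF B'(1)] show ?thesis
      by (metis add.commute nat_le_linear)
  qed
qed

text \<open>Equality follows by exchanging the bases. If \<open>e' < d'\<close>, both elements of
  the second basis would be multiples of \<open>(f, g)\<close>, hence dependent.\<close>

lemma hbasis_degrees_le:
  assumes B: "hbasis \<mu> f g d f' g' d'" "d \<le> d'" and C: "hbasis \<mu> u v e u' v' e'" "e \<le> e'"
  shows "d \<le> e" "d' \<le> e'"
proof -
  have h: "hinD \<mu> e u v" "hinD \<mu> e' u' v'" using hbasis_hinD[OF C(1)] .
  have ind: "a = 0 \<and> b = 0" if "a * u + b * u' = 0" "a * v + b * v' = 0" for a b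
    using C that unfolding hbasis_def by blast
  obtain a b where ab: "a = 0 \<or> d \<le> e \<and> homogeneous (e - d) a"
    "b = 0 \<or> d' \<le> e \<and> homogeneous (e - d') b" "u = a * f + b * f'" "v = a * g + b * g'"
    using hom_span[OF B(1) h(1)] .
  obtain a' b' where ab': "a' = 0 \<or> d \<le> e' \<and> homogeneous (e' - d) a'"
    "b' = 0 \<or> d' \<le> e' \<and> homogeneous (e' - d') b'" "u' = a' * f + b' * f'" "v' = a' * g + b' * g'"
    using hom_span[OF B(1) h(2)] .
  have "u \<noteq> 0 \<or> v \<noteq> 0" using ind[of 1 0] by auto
  thus "d \<le> e" using ab B(2) by auto
  show "d' \<le> e'"
  proof (rule ccontr)
    assume "\<not> d' \<le> e'"
    hence "b = 0" "b' = 0" using ab(2) ab'(2) C(2) by auto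
    with ab(3,4) ab'(3,4) have "a' = 0 \<and> - a = 0" by (intro ind) (auto simp: algebra_simps)
    with \<open>b = 0\<close> ab(3,4) \<open>u \<noteq> 0 \<or> v \<noteq> 0\<close> show False by simp
  qed
qed

end

section \<open>Derivations and the difference of exponents\<close>

lemma map_poly_pderiv_add: "map_poly pderiv (p + q) = map_poly pderiv p + map_poly pderiv q"
  by (simp add: poly_eq_iff coeff_map_poly pderiv_add)

lemma pderiv_sum: "pderiv (sum f B) = (\<Sum>x\<in>B. pderiv (f x))"
  by (induction B rule: infinite_finite_induct) (simp_all add: pderiv_add)

lemma map_poly_pderiv_mult:
  "map_poly pderiv (p * q) = map_poly pderiv p * q + p * map_poly pderiv q"
proof (rule poly_eqI)
  fix n
  have *: "pderiv (a * b) = pderiv a * b + a * pderiv b" for a b :: "'a poly"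
    by (simp add: pderiv_mult mult.commute add.commute)
  have "coeff (map_poly pderiv (p * q)) n = (\<Sum>i\<le>n. pderiv (coeff p i * coeff q (n - i)))"
    by (simp add: coeff_map_poly coeff_mult pderiv_sum)
  also have "\<dots> = coeff (map_poly pderiv p * q + p * map_poly pderiv q) n"
    by (simp add: coeff_map_poly coeff_mult * sum.distrib)
  finally show "coeff (map_poly pderiv (p * q)) n =
    coeff (map_poly pderiv p * q + p * map_poly pderiv q) n" .
qed

lemma vector_space_smult_const: "vector_space (\<lambda>c. smult [:c::'k::field:])"
  by unfold_locales (simp_all add: smult_add_left[symmetric] smult_add_right one_pCons[symmetric] mult.commute)

lemma smult_const_eq_mult: "smult [:c:] p = [:[:c:]:] * p"
  by simp

lemma der_of_in_derivations: "der_of f g \<in> derivations"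
proof -
  have "map_poly pderiv [:[:c:]:] = 0" "pderiv [:[:c:]:] = 0" for c :: 'a
    by (simp_all add: map_poly_pCons pderiv_pCons)
  hence "der_of f g (smult [:c:] p) = smult [:c:] (der_of f g p)" for c p
    unfolding smult_const_eq_mult der_of_def map_poly_pderiv_mult pderiv_mult
    by (simp add: algebra_simps smult_add_right)
  moreover have "der_of f g (p + q) = der_of f g p + der_of f g q" for p q
    by (simp add: der_of_def map_poly_pderiv_add pderiv_add algebra_simps)
  moreover have "der_of f g (p * q) = der_of f g p * q + p * der_of f g q" for p q
    by (simp add: der_of_def map_poly_pderiv_mult pderiv_mult algebra_simps)
  ultimately show ?thesis
    by (simp add: derivations_def Vector_Spaces.linear_iff vector_space_smult_const)
qed

lemma smult_one: "smult [:1:] p = (p :: 'a::comm_semiring_1 poly poly)"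
  by (simp flip: one_pCons)

lemma der_of_X [simp]: "der_of f g [:[:0, 1:]:] = f"
  and der_of_Y [simp]: "der_of f g [:0, 1:] = g"
  by (simp_all add: der_of_def map_poly_pCons pderiv_pCons one_pCons smult_one)

lemma der_of_form: "der_of f g [:[:0, a:], [:b:]:] = [:[:a:]:] * f + [:[:b:]:] * g"
  by (simp add: der_of_def map_poly_pCons pderiv_pCons mult.commute)

lemma der_of_inject: "der_of f g = der_of f' g' \<longleftrightarrow> f = f' \<and> g = g'"
  by (metis der_of_X der_of_Y)

lemma der_of_0: "der_of 0 0 = 0"
  and der_of_add: "der_of f g + der_of f' g' = der_of (f + f') (g + g')"
  and der_scale_der_of: "der_scale r (der_of f g) = der_of (r * f) (r * g)"
  by (auto simp: der_of_def der_scale_def algebra_simps)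

text \<open>\<open>[:[:0, 1:]:]\<close> is \<open>x\<close> and \<open>[:0, 1:]\<close> is
  \<open>y\<close>. Constants are killed, so agreement spreads by Horner steps, first through
  \<open>K[x]\<close> and then through \<open>K[x][y]\<close>.\<close>

lemma derivation_eqI:
  assumes d: "\<delta> \<in> derivations" "\<delta>' \<in> derivations"
    and eq: "\<delta> [:[:0, 1:]:] = \<delta>' [:[:0, 1:]:]" "\<delta> [:0, 1:] = \<delta>' [:0, 1:]"
  shows "\<delta> = \<delta>'"
proof
  have mult: "\<delta> (p * q) = \<delta> p * q + p * \<delta> q" "\<delta>' (p * q) = \<delta>' p * q + p * \<delta>' q" for p q
    using d by (auto simp: derivations_def)
  have lin: "\<delta> (p + q) = \<delta> p + \<delta> q" "\<delta>' (p + q) = \<delta>' p + \<delta>' q"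
    "\<delta> (smult [:c:] p) = smult [:c:] (\<delta> p)" "\<delta>' (smult [:c:] p) = smult [:c:] (\<delta>' p)" for p q c
    using d by (auto simp: derivations_def Vector_Spaces.linear_iff)
  have "\<delta> 1 = 0" "\<delta>' 1 = 0" using mult[of 1 1] by (metis add_cancel_right_left mult_1 mult_1_right)+
  hence const: "\<delta> [:[:c:]:] = 0" "\<delta>' [:[:c:]:] = 0" for c
    using lin(3)[of c 1] lin(4)[of c 1] by simp_all
  have inner: "\<delta> [:a:] = \<delta>' [:a:]" for a
  proof (induction a)
    case (pCons c a)
    have "[:pCons c a:] = [:[:c:]:] + [:[:0, 1:]:] * [:a:]" by simp
    thus ?case using pCons by (simp only: lin mult const eq)
  qed (use lin(3,4)[of 0 0] in simp)
  fix p show "\<delta> p = \<delta>' p"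
  proof (induction p)
    case (pCons c p)
    have "pCons c p = [:c:] + [:0, 1:] * p" by simp
    thus ?case using pCons by (simp only: lin mult inner eq)
  qed (use inner[of 0] in simp)
qed

lemma derivation_eq_der_of:
  "\<delta> \<in> derivations \<Longrightarrow> \<delta> = der_of (\<delta> [:[:0, 1:]:]) (\<delta> [:0, 1:])"
  by (rule derivation_eqI) (simp_all add: der_of_in_derivations)

lemma module_der_scale: "module der_scale"
  by unfold_locales (auto simp: der_scale_def algebra_simps)

lemma der_span_pair:
  "module.span der_scale {\<theta>, \<theta>'} = {der_scale a \<theta> + der_scale b \<theta>' |a b. True}"
proof -
  interpret module der_scale by (rule module_der_scale)
  show ?thesis
    by (auto simp: span_insert span_singleton algebra_simps)
qed

lemma der_dependent_pair:
  assumes "\<theta> \<noteq> \<theta>'"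
  shows "module.dependent der_scale {\<theta>, \<theta>'} \<longleftrightarrow>
    (\<exists>a b. (a \<noteq> 0 \<or> b \<noteq> 0) \<and> der_scale a \<theta> + der_scale b \<theta>' = 0)" (is "?l \<longleftrightarrow> ?r")
proof -
  interpret module der_scale by (rule module_der_scale)
  have *: "dependent {\<theta>, \<theta>'} \<longleftrightarrow>
    (\<exists>u. (u \<theta> \<noteq> 0 \<or> u \<theta>' \<noteq> 0) \<and> der_scale (u \<theta>) \<theta> + der_scale (u \<theta>') \<theta>' = 0)"
    using assms by (subst dependent_finite) auto
  show ?thesis
  proof
    assume ?r
    then obtain a b where "a \<noteq> 0 \<or> b \<noteq> 0" "der_scale a \<theta> + der_scale b \<theta>' = 0" by blast
    thus ?l unfolding * using assms by (intro exI[of _ "\<lambda>x. if x = \<theta> then a else b"]) auto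
  qed (use * in blast)
qed

context line_arrangement
begin

lemma der_of_lf: "der_of f g (lf H) = val H f g"
  by (simp only: lf_def val_def der_of_form)

lemma D_mod_eq: "D_mod A lf \<mu> = {der_of f g |f g. inD \<mu> f g}"
proof (intro equalityI subsetI)
  fix \<delta> assume d: "\<delta> \<in> D_mod A lf \<mu>"
  then obtain f g where "\<delta> = der_of f g" using derivation_eq_der_of unfolding D_mod_def by blast
  with d show "\<delta> \<in> {der_of f g |f g. inD \<mu> f g}" by (auto simp: D_mod_def inD_def der_of_lf)
qed (auto simp: D_mod_def inD_def der_of_lf der_of_in_derivations)

text \<open>The bridge between derivations and pairs: injectivity of \<open>der_of\<close> turns
  equations between the former into equations between the latter.\<close>

lemma homogeneous_basis_iff:
  "homogeneous_basis (D_mod A lf \<mu>) \<theta> d \<theta>' d' \<longleftrightarrow>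
    (\<exists>f g f' g'. \<theta> = der_of f g \<and> \<theta>' = der_of f' g' \<and> hbasis \<mu> f g d f' g' d')"
proof
  assume l: "homogeneous_basis (D_mod A lf \<mu>) \<theta> d \<theta>' d'"
  then obtain f g f' g' where t: "\<theta> = der_of f g" "\<theta>' = der_of f' g'"
    "homogeneous d f" "homogeneous d g" "homogeneous d' f'" "homogeneous d' g'"
    by (auto simp: homogeneous_basis_def der_degree_def)
  have span: "{der_of (a * f + b * f') (a * g + b * g') |a b. True} = {der_of f g |f g. inD \<mu> f g}"
    using l by (simp add: homogeneous_basis_def D_mod_eq der_span_pair t der_scale_der_of der_of_add)
  hence span': "inD \<mu> p q \<longleftrightarrow> (\<exists>a b. p = a * f + b * f' \<and> q = a * g + b * g')" for p q
    unfolding set_eq_iff mem_Collect_eq by (metis der_of_inject)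
  have "inD \<mu> f g" unfolding span' by (intro exI[of _ 1] exI[of _ 0]) simp
  moreover have "inD \<mu> f' g'" unfolding span' by (intro exI[of _ 1] exI[of _ 0]) simp
  moreover have "a = 0 \<and> b = 0" if "a * f + b * f' = 0 \<and> a * g + b * g' = 0" for a b
  proof -
    have "der_scale a \<theta> + der_scale b \<theta>' = 0"
      by (simp only: t der_scale_der_of der_of_add that der_of_0)
    thus ?thesis using l der_dependent_pair[of \<theta> \<theta>'] unfolding homogeneous_basis_def by blast
  qed
  ultimately have "hbasis \<mu> f g d f' g' d'"
    unfolding hbasis_def hinD_def using t span' by blast
  thus "\<exists>f g f' g'. \<theta> = der_of f g \<and> \<theta>' = der_of f' g' \<and> hbasis \<mu> f g d f' g' d'"
    using t by blast
next
  assume "\<exists>f g f' g'. \<theta> = der_of f g \<and> \<theta>' = der_of f' g' \<and> hbasis \<mu> f g d f' g' d'"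
  then obtain f g f' g' where t: "\<theta> = der_of f g" "\<theta>' = der_of f' g'"
    and B: "hbasis \<mu> f g d f' g' d'" by blast
  note D = hbasis_hinD[OF B]
  have ind: "a = 0 \<and> b = 0" if "a * f + b * f' = 0" "a * g + b * g' = 0" for a b
    using B that unfolding hbasis_def by blast
  have ne: "\<theta> \<noteq> \<theta>'" using ind[of 1 "- 1"] by (auto simp: t der_of_inject)
  have "\<not> module.dependent der_scale {\<theta>, \<theta>'}"
    using der_dependent_pair[OF ne] ind
    unfolding t der_scale_der_of der_of_add der_of_0[symmetric] der_of_inject by blast
  moreover have "inD \<mu> (a * f + b * f') (a * g + b * g')" for a b
    using D by (intro inD_add inD_mult) (simp_all add: hinD_def)
  hence "module.span der_scale {\<theta>, \<theta>'} = D_mod A lf \<mu>"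
    unfolding D_mod_eq der_span_pair t der_scale_der_of der_of_add
    using B unfolding hbasis_def by blast
  moreover have "der_degree \<theta> d" "der_degree \<theta>' d'"
    using D t unfolding der_degree_def hinD_def by blast+
  ultimately show "homogeneous_basis (D_mod A lf \<mu>) \<theta> d \<theta>' d'"
    using ne by (simp add: homogeneous_basis_def)
qed

lemma hbasis_degree_diff_unique:
  assumes B: "hbasis \<mu> f g d f' g' d'" "d \<le> d'" and C: "hbasis \<mu> u v e u' v' e'"
  shows "\<bar>int e - int e'\<bar> = int d' - int d"
proof (cases "e \<le> e'")
  case True
  thus ?thesis using hbasis_degrees_le[OF B C] hbasis_degrees_le[OF C _ B] by simp
next
  case False
  note C' = hbasis_swap[OF C]
  from False show ?thesis using hbasis_degrees_le[OF B C'] hbasis_degrees_le[OF C' _ B] by simp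
qed

lemma Delta_eq:
  assumes "hbasis \<mu> f g d f' g' d'" "d \<le> d'"
  shows "Delta A lf \<mu> = int d' - int d"
  unfolding Delta_def homogeneous_basis_iff
proof (rule the_equality)
  show "\<exists>\<theta> e \<theta>' e'. (\<exists>f g f' g'. \<theta> = der_of f g \<and> \<theta>' = der_of f' g' \<and> hbasis \<mu> f g e f' g' e') \<and>
    int d' - int d = \<bar>int e - int e'\<bar>"
    using assms hbasis_degree_diff_unique[OF assms assms(1)] by metis
qed (use hbasis_degree_diff_unique[OF assms] in blast)

text \<open>The smaller exponent is at most \<open>e\<close>, hence below half of the sum of the
  exponents, so the two differ.\<close>

lemma low_degree_imp_Delta_pos:
  assumes "hinD \<mu> e f g" "f \<noteq> 0 \<or> g \<noteq> 0" "2 * e < msize A \<mu>"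
  shows "Delta A lf \<mu> > 0"
proof -
  obtain f1 g1 d f2 g2 d' where B: "hbasis \<mu> f1 g1 d f2 g2 d'" "d \<le> d'" "d + d' = msize A \<mu>"
    using hbasis_exists by blast
  have "d \<le> e" using hom_span[OF B(1) assms(1)] assms(2) B(2)
    by (metis add.right_neutral le_trans mult_zero_left)
  thus ?thesis using Delta_eq[OF B(1,2)] B(3) assms(3) by simp
qed

lemma Delta_nonneg: "Delta A lf \<mu> \<ge> 0"
  using hbasis_exists[of \<mu>] Delta_eq[of \<mu>] by fastforce

lemma even_Delta_iff: "even (Delta A lf \<mu>) \<longleftrightarrow> even (msize A \<mu>)"
proof -
  obtain f1 g1 d f2 g2 d' where B: "hbasis \<mu> f1 g1 d f2 g2 d'" "d \<le> d'" "d + d' = msize A \<mu>"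
    using hbasis_exists by blast
  show ?thesis unfolding Delta_eq[OF B(1,2)] B(3)[symmetric] by auto
qed

section \<open>The generator of least degree\<close>

text \<open>
  The clause on \<open>e\<close> includes \<open>2 * e = msize A \<mu>\<close>: it is what survives passing to a neighbour.
\<close>

definition generator :: "('h \<Rightarrow> nat) \<Rightarrow> nat \<Rightarrow> 'k poly poly \<Rightarrow> 'k poly poly \<Rightarrow> bool" where
  "generator \<mu> d f g \<longleftrightarrow> hinD \<mu> d f g \<and> (f \<noteq> 0 \<or> g \<noteq> 0) \<and> 2 * d < msize A \<mu> \<and>
    (\<forall>e p q. hinD \<mu> e p q \<longrightarrow> 2 * e \<le> msize A \<mu> \<longrightarrow> p \<noteq> 0 \<or> q \<noteq> 0 \<longrightarrow>
       d \<le> e \<and> (\<exists>a. homogeneous (e - d) a \<and> p = a * f \<and> q = a * g))"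

text \<open>From \<open>d < d'\<close> and \<open>d + d' = |\<mu>|\<close> follows
  \<open>2 d < |\<mu>| < 2 d'\<close>, so an element of degree at most \<open>|\<mu>| / 2\<close>
  has no component along the second basis element.\<close>

lemma Delta_pos_imp_generator:
  assumes "Delta A lf \<mu> > 0"
  obtains d f g where "generator \<mu> d f g"
proof -
  obtain f g d f' g' d' where B: "hbasis \<mu> f g d f' g' d'" "d \<le> d'" "d + d' = msize A \<mu>"
    using hbasis_exists by blast
  have lt: "d < d'" using assms Delta_eq[OF B(1,2)] by simp
  have "f \<noteq> 0 \<or> g \<noteq> 0"
  proof (rule ccontr)
    assume "\<not> (f \<noteq> 0 \<or> g \<noteq> 0)"
    hence "1 * f + 0 * f' = 0 \<and> 1 * g + 0 * g' = 0" by simp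
    hence "(1 :: 'k poly poly) = 0" using B(1) unfolding hbasis_def by blast
    thus False by simp
  qed
  moreover have "d \<le> e \<and> (\<exists>a. homogeneous (e - d) a \<and> p = a * f \<and> q = a * g)"
    if h: "hinD \<mu> e p q" "2 * e \<le> msize A \<mu>" "p \<noteq> 0 \<or> q \<noteq> 0" for e p q
  proof -
    obtain a b where ab: "a = 0 \<or> d \<le> e \<and> homogeneous (e - d) a" "b = 0 \<or> d' \<le> e \<and> homogeneous (e - d') b"
      "p = a * f + b * f'" "q = a * g + b * g'" using hom_span[OF B(1) h(1)] .
    have "b = 0" using ab(2) h(2) lt B(3) by auto
    thus ?thesis using ab h(3) by auto
  qed
  ultimately have "generator \<mu> d f g"
    unfolding generator_def using hbasis_hinD[OF B(1)] lt B(3) by auto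
  thus ?thesis by (rule that)
qed

end

section \<open>Components of the Hasse graph\<close>

lemma finite_Lam_bounded:
  assumes "finite A" shows "finite {\<mu> \<in> Lam A. msize A \<mu> < n}"
proof (rule finite_subset)
  show "{\<mu> \<in> Lam A. msize A \<mu> < n} \<subseteq> A \<rightarrow>\<^sub>E {..<n}"
  proof
    fix \<mu> assume \<mu>: "\<mu> \<in> {\<mu> \<in> Lam A. msize A \<mu> < n}"
    have "\<mu> H < n" if "H \<in> A" for H
      using \<mu> member_le_sum[OF that, of \<mu>] assms by (auto simp: msize_def)
    thus "\<mu> \<in> A \<rightarrow>\<^sub>E {..<n}" using \<mu> by (auto simp: Lam_def PiE_def Pi_def)
  qed
qed (use assms in \<open>auto intro: finite_PiE\<close>)

lemma msize_Suc:
  assumes "finite A" "H \<in> A" shows "msize A (\<mu>(H := Suc (\<mu> H))) = Suc (msize A \<mu>)"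
  unfolding msize_def sum.remove[OF assms] by simp

text \<open>Natural differences adding up to 1 are concentrated in one line; outside
  \<open>A\<close> both functions are \<open>undefined\<close>.\<close>

lemma mcover_imp_Suc:
  assumes "finite A" "\<mu> \<in> Lam A" "\<nu> \<in> Lam A" "mcover A \<mu> \<nu>"
  shows "\<exists>H\<in>A. \<nu> = \<mu>(H := Suc (\<mu> H))"
proof -
  have le: "\<mu> H \<le> \<nu> H" if "H \<in> A" for H using assms(4) that by (auto simp: mcover_def mle_def)
  have "(\<Sum>H\<in>A. \<nu> H - \<mu> H) = Suc 0"
    using sum_subtractf_nat[of A \<mu> \<nu>] le assms(4) by (simp add: mcover_def msize_def)
  then obtain H where H: "H \<in> A" "\<nu> H - \<mu> H = Suc 0" "\<forall>H'\<in>A. H \<noteq> H' \<longrightarrow> \<nu> H' - \<mu> H' = 0"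
    using assms(1) by (auto simp: sum_eq_Suc0_iff)
  have "\<nu> x = (\<mu>(H := Suc (\<mu> H))) x" for x
  proof (cases "x \<in> A")
    case True
    thus ?thesis using H le[of x] by (cases "x = H") (auto simp: le_antisym)
  next
    case False
    hence "\<nu> x = undefined" "\<mu> x = undefined" using assms(2,3) by (auto simp: Lam_def)
    thus ?thesis using False H(1) by auto
  qed
  thus ?thesis using H(1) by blast
qed

lemma hasse_edgesE:
  assumes "(\<mu>, \<nu>) \<in> hasse_edges A" "finite A"
  obtains H where "H \<in> A" "\<nu> = \<mu>(H := Suc (\<mu> H))" | H where "H \<in> A" "\<mu> = \<nu>(H := Suc (\<nu> H))"
proof -
  have "\<mu> \<in> Lam A" "\<nu> \<in> Lam A" "mcover A \<mu> \<nu> \<or> mcover A \<nu> \<mu>"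
    using assms(1) by (auto simp: hasse_edges_def)
  thus ?thesis
    using mcover_imp_Suc[OF assms(2), of \<mu> \<nu>] mcover_imp_Suc[OF assms(2), of \<nu> \<mu>] that by blast
qed

lemma hasse_edges_Suc:
  assumes "finite A" "H \<in> A" "\<mu> \<in> Lam A" "\<mu>(H := Suc (\<mu> H)) \<in> Lam A"
  shows "(\<mu>(H := Suc (\<mu> H)), \<mu>) \<in> hasse_edges A"
  using assms msize_Suc[OF assms(1,2), of \<mu>] by (auto simp: hasse_edges_def mcover_def mle_def)

text \<open>Reachability inside \<open>X\<close>; by \<open>max_components_eq\<close> these classes
  are the maximal connected subsets, so maximality over all connected supersets need not be handled
  again.\<close>

definition component :: "'h set \<Rightarrow> ('h \<Rightarrow> nat) set \<Rightarrow> ('h \<Rightarrow> nat) \<Rightarrow> ('h \<Rightarrow> nat) set" where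
  "component A X \<mu> = {\<nu>. (\<mu>, \<nu>) \<in> (hasse_edges A \<inter> X \<times> X)\<^sup>*}"

lemma sym_hasse_rtrancl: "sym ((hasse_edges A \<inter> X \<times> X)\<^sup>*)"
  by (intro sym_rtrancl) (auto simp: sym_def hasse_edges_def)

lemma hasse_connected_subset_component:
  assumes "hasse_connected A C" "C \<subseteq> X" "\<mu> \<in> C" shows "C \<subseteq> component A X \<mu>"
proof -
  have "(hasse_edges A \<inter> C \<times> C)\<^sup>* \<subseteq> (hasse_edges A \<inter> X \<times> X)\<^sup>*"
    using assms(2) by (intro rtrancl_mono) blast
  thus ?thesis using assms(1,3) unfolding hasse_connected_def component_def by blast
qed

lemma component_subset:
  assumes "\<mu> \<in> X" shows "component A X \<mu> \<subseteq> X"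
proof
  fix \<nu> assume "\<nu> \<in> component A X \<mu>"
  hence "(\<mu>, \<nu>) \<in> (hasse_edges A \<inter> X \<times> X)\<^sup>*" by (simp add: component_def)
  thus "\<nu> \<in> X" by (induction rule: rtrancl_induct) (use assms in auto)
qed

lemma component_connected:
  assumes "X \<subseteq> Lam A" "\<mu> \<in> X"
  shows "hasse_connected A (component A X \<mu>)"
proof -
  let ?C = "component A X \<mu>"
  have *: "(\<mu>, \<nu>) \<in> (hasse_edges A \<inter> ?C \<times> ?C)\<^sup>*" if "\<nu> \<in> ?C" for \<nu>
    using that unfolding component_def[of A X \<mu>] mem_Collect_eq
  proof (induction rule: rtrancl_induct)
    case (step y z)
    have "(y, z) \<in> hasse_edges A \<inter> ?C \<times> ?C"
      using step.hyps by (auto simp: component_def intro: rtrancl_into_rtrancl)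
    thus ?case using step.IH by (auto simp: component_def[symmetric] intro: rtrancl_into_rtrancl)
  qed simp
  have "(\<nu>, \<nu>') \<in> (hasse_edges A \<inter> ?C \<times> ?C)\<^sup>*" if "\<nu> \<in> ?C" "\<nu>' \<in> ?C" for \<nu> \<nu>'
    by (rule rtrancl_trans[OF symD[OF sym_hasse_rtrancl *[OF that(1)]] *[OF that(2)]])
  moreover have "\<mu> \<in> ?C" by (simp add: component_def)
  ultimately show ?thesis
    using component_subset[OF assms(2), of A] assms(1) by (auto simp: hasse_connected_def)
qed

lemma max_components_eq:
  assumes "X \<subseteq> Lam A" shows "max_components A X = component A X ` X"
proof (intro equalityI subsetI)
  fix C assume C: "C \<in> max_components A X"
  then obtain \<mu> where \<mu>: "\<mu> \<in> C" "\<mu> \<in> X" by (auto simp: max_components_def hasse_connected_def)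
  have "C \<subseteq> component A X \<mu>"
    using C \<mu> hasse_connected_subset_component[of A C X \<mu>] by (auto simp: max_components_def)
  hence "component A X \<mu> = C"
    using C component_connected[OF assms \<mu>(2)] component_subset[OF \<mu>(2), of A]
    by (auto simp: max_components_def)
  thus "C \<in> component A X ` X" using \<mu>(2) by blast
next
  fix C assume "C \<in> component A X ` X"
  then obtain \<mu> where \<mu>: "\<mu> \<in> X" "C = component A X \<mu>" by blast
  have "\<mu> \<in> C" by (simp add: \<mu> component_def)
  thus "C \<in> max_components A X"
    using component_connected[OF assms \<mu>(1)] component_subset[OF \<mu>(1), of A]
      hasse_connected_subset_component[of A _ X \<mu>]
    unfolding max_components_def \<mu>(2) by blast
qed

lemma component_eqI:
  assumes "hasse_connected A Y" "Y \<subseteq> X" "\<mu> \<in> Y"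
    and closed: "\<And>y z. (y, z) \<in> hasse_edges A \<Longrightarrow> y \<in> Y \<Longrightarrow> z \<in> X \<Longrightarrow> z \<in> Y"
  shows "component A X \<mu> = Y"
proof
  show "component A X \<mu> \<subseteq> Y"
  proof
    fix \<nu> assume "\<nu> \<in> component A X \<mu>"
    hence "(\<mu>, \<nu>) \<in> (hasse_edges A \<inter> X \<times> X)\<^sup>*" by (simp add: component_def)
    thus "\<nu> \<in> Y" by (induction rule: rtrancl_induct) (use assms(3) closed in auto)
  qed
qed (rule hasse_connected_subset_component[OF assms(1-3)])

lemma Lam_H_iff: "\<mu> \<in> Lam_H A H \<longleftrightarrow> \<mu> \<in> Lam A \<and> msize A \<mu> < 2 * \<mu> H"
proof -
  have "real (\<mu> H) > real (msize A \<mu>) / 2 \<longleftrightarrow> real (2 * \<mu> H) > real (msize A \<mu>)" by auto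
  thus ?thesis unfolding Lam_H_def of_nat_less_iff by simp
qed

lemma Lam_circ_eq: "Lam_circ A = Lam A - (\<Union>H\<in>A. Lam_H A H)"
  by (auto simp: Lam_circ_def Lam_H_def not_less)

lemma Lam_H_connected:
  assumes A: "finite A" "H \<in> A"
  shows "hasse_connected A (Lam_H A H)"
proof -
  let ?L = "Lam_H A H"
  \<comment> \<open>The indicator of \<open>H\<close> is the least element of
    \<open>Lam_H A H\<close>; every other element descends to it one unit at a time.\<close>
  define \<delta> where "\<delta> = restrict (\<lambda>H'. if H' = H then 1 else 0 :: nat) A"
  have **: "(\<mu>, \<delta>) \<in> (hasse_edges A \<inter> ?L \<times> ?L)\<^sup>*" if "msize A \<mu> = n" "\<mu> \<in> ?L" for \<mu> n
    using that
  proof (induction n arbitrary: \<mu>)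
    case 0
    have "\<mu> H \<le> msize A \<mu>" unfolding msize_def using A by (intro member_le_sum) auto
    thus ?case using 0 by (simp add: Lam_H_iff)
  next
    case (Suc n)
    have \<mu>: "\<mu> \<in> Lam A" "msize A \<mu> < 2 * \<mu> H" using Suc.prems(2) by (auto simp: Lam_H_iff)
    show ?case
    proof (cases "\<mu> = \<delta>")
      case False
      \<comment> \<open>Lowering another line keeps the strict majority of \<open>H\<close>.
        Lowering \<open>H\<close> itself keeps it only under the stated inequality, which holds when
        all the weight lies on \<open>H\<close> and exceeds 1.\<close>
      have "\<exists>H'\<in>A. \<mu> H' > 0 \<and> (H' = H \<longrightarrow> msize A \<mu> + 1 < 2 * \<mu> H)"
      proof (cases "\<exists>H'\<in>A. H' \<noteq> H \<and> \<mu> H' > 0")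
        case False
        hence z: "\<mu> H' = 0" if "H' \<in> A" "H' \<noteq> H" for H' using that by auto
        have s: "msize A \<mu> = \<mu> H" unfolding msize_def sum.remove[OF A] using z by simp
        have "\<mu> H \<noteq> 1"
        proof
          assume "\<mu> H = 1"
          have "\<mu> x = \<delta> x" for x
            using \<open>\<mu> H = 1\<close> z[of x] PiE_arb[OF \<mu>(1)[unfolded Lam_def], of x]
            by (cases "x \<in> A"; cases "x = H") (simp_all add: \<delta>_def)
          hence "\<mu> = \<delta>" by (rule ext)
          with \<open>\<mu> \<noteq> \<delta>\<close> show False ..
        qed
        thus ?thesis using A(2) s \<mu>(2) by (intro bexI[of _ H]) auto
      qed blast
      then obtain H' where H': "H' \<in> A" "\<mu> H' > 0" "H' = H \<longrightarrow> msize A \<mu> + 1 < 2 * \<mu> H"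
        by blast
      define \<nu> where "\<nu> = \<mu>(H' := \<mu> H' - 1)"
      have eq: "\<mu> = \<nu>(H' := Suc (\<nu> H'))" using H'(2) by (auto simp: \<nu>_def)
      have s: "msize A \<mu> = Suc (msize A \<nu>)" by (subst eq) (rule msize_Suc[OF A(1) H'(1)])
      have \<nu>: "\<nu> \<in> Lam A" using \<mu>(1) H'(1) by (auto simp: \<nu>_def Lam_def PiE_def extensional_def)
      have "\<nu> H = (if H' = H then \<mu> H - 1 else \<mu> H)" by (simp add: \<nu>_def)
      hence L: "\<nu> \<in> ?L"
        unfolding Lam_H_iff using \<nu> s \<mu>(2) H'(3) by (cases "H' = H") simp_all
      have "(\<mu>, \<nu>) \<in> hasse_edges A"
        by (subst eq, rule hasse_edges_Suc[OF A(1) H'(1) \<nu>]) (use eq \<mu>(1) in metis)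
      hence "(\<mu>, \<nu>) \<in> hasse_edges A \<inter> ?L \<times> ?L" using Suc.prems(2) L by blast
      moreover have "(\<nu>, \<delta>) \<in> (hasse_edges A \<inter> ?L \<times> ?L)\<^sup>*"
        by (rule Suc.IH[OF _ L]) (use s Suc.prems(1) in simp)
      ultimately show ?thesis by (rule converse_rtrancl_into_rtrancl)
    qed simp
  qed
  note * = **[OF refl]
  have ***: "(\<mu>, \<nu>) \<in> (hasse_edges A \<inter> ?L \<times> ?L)\<^sup>*" if "\<mu> \<in> ?L" "\<nu> \<in> ?L" for \<mu> \<nu>
    by (rule rtrancl_trans[OF *[OF that(1)] symD[OF sym_hasse_rtrancl *[OF that(2)]]])
  have \<delta>: "\<delta> H = 1" "\<And>H'. H' \<in> A - {H} \<Longrightarrow> \<delta> H' = 0" using A(2) by (simp_all add: \<delta>_def)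
  have "msize A \<delta> = 1"
    unfolding msize_def sum.remove[OF A] \<delta>(1) by (subst sum.neutral) (use \<delta>(2) in auto)
  moreover have "\<delta> \<in> Lam A" by (simp add: \<delta>_def Lam_def)
  ultimately have "\<delta> \<in> ?L" unfolding Lam_H_iff \<delta>(1) by (simp only:) simp
  moreover have "?L \<subseteq> Lam A" by (auto simp: Lam_H_iff)
  ultimately show ?thesis using *** unfolding hasse_connected_def by blast
qed

lemma infinite_Lam_H:
  assumes A: "finite A" "H \<in> A"
  shows "infinite (Lam_H A H)"
proof -
  \<comment> \<open>\<open>Suc\<close> skips the zero multiplicity, in which \<open>H\<close> has no
    strict majority.\<close>
  define \<delta> where "\<delta> m = restrict (\<lambda>H'. if H' = H then Suc m else 0) A" for m
  have H: "\<delta> m H = Suc m" for m using A(2) by (simp add: \<delta>_def)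
  have "inj \<delta>"
  proof (rule injI)
    fix m n assume "\<delta> m = \<delta> n"
    hence "\<delta> m H = \<delta> n H" by (rule arg_cong)
    thus "m = n" unfolding H by (rule Suc_inject)
  qed
  have z: "\<delta> m H' = 0" if "H' \<in> A - {H}" for m H' using that by (simp add: \<delta>_def)
  have "msize A (\<delta> m) = Suc m" for m
    unfolding msize_def sum.remove[OF A] H by (subst sum.neutral) (use z in auto)
  moreover have "\<delta> m \<in> Lam A" for m by (simp add: \<delta>_def Lam_def)
  ultimately have "range \<delta> \<subseteq> Lam_H A H" unfolding Lam_H_iff image_subset_iff H by simp
  with \<open>inj \<delta>\<close> show ?thesis by (auto simp: infinite_iff_countable_subset)
qed

section \<open>Components of \<open>\<Lambda>'\<close>\<close>

context line_arrangement
begin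

text \<open>The forms of distinct lines are coprime: the product collected so far does not vanish on
  the next line, so the power of its form must divide the cofactor.\<close>

lemma prod_lf_power_dvd:
  assumes "homogeneous d p" "B \<subseteq> A" "\<And>H. H \<in> B \<Longrightarrow> lf H ^ m H dvd p"
  shows "(\<Prod>H\<in>B. lf H ^ m H) dvd p"
proof -
  have "finite B" using assms(2) finite_A finite_subset by blast
  thus ?thesis using assms(2,3)
  proof (induction B rule: finite_induct)
    case (insert H B)
    let ?Q = "\<Prod>H\<in>B. lf H ^ m H"
    have hQ: "homogeneous (sum m B) ?Q" by (rule homogeneous_prod) (rule homogeneous_lf_power)
    have "?Q dvd p" using insert by blast
    thus ?case
    proof (rule homogeneous_dvdE[OF _ hQ assms(1)])
      fix r assume r: "homogeneous (d - sum m B) r" "p = r * ?Q"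
      have "ev_on H ?Q \<noteq> 0"
        unfolding ev_on_prod using insert.hyps insert.prems(1) ev_on_lf[of H] by auto
      moreover have "lf H ^ m H dvd ?Q * r" using insert.prems(2)[of H] r(2) by (simp add: mult.commute)
      ultimately have "lf H ^ m H dvd r"
        using lf_power_dvd_cancel[OF _ r(1)] insert.prems(1) by blast
      thus ?thesis using insert.hyps r(2) by (simp add: mult_dvd_mono)
    qed simp
  qed simp
qed

text \<open>
  If \<open>\<theta>(\<alpha>\<^sub>H) = 0\<close>, then \<open>\<theta>\<close> is a polynomial multiple of the derivation along \<open>H\<close>, and the
  coefficient is divisible by \<open>\<alpha>\<close> to the power \<open>\<mu>\<close> for every other line.
\<close>

lemma hinD_annihilating:
  assumes H: "H \<in> A" and h: "hinD \<mu> d f g" "f \<noteq> 0 \<or> g \<noteq> 0" and v: "val H f g = 0"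
  shows "msize A \<mu> \<le> d + \<mu> H"
proof -
  have hom: "homogeneous d f" "homogeneous d g" using h(1) by (auto simp: hinD_def)
  \<comment> \<open>Being annihilated by \<open>\<alpha>_H\<close>, the pair is \<open>p\<close>
    times the vector \<open>(- cb H, ca H)\<close>; \<open>p\<close> is found by dividing by a
    nonzero coordinate.\<close>
  obtain p where p: "homogeneous d p" "f = [:[:- cb H:]:] * p" "g = [:[:ca H:]:] * p"
  proof (cases "ca H = 0")
    case True
    with nonzero[OF H] have "cb H \<noteq> 0" by simp
    with True v show ?thesis
      by (intro that[of "[:[:- 1 / cb H:]:] * f"] homogeneous_const_mult hom)
         (auto simp: val_def smult_one)
  next
    case False
    have "[:[:ca H:]:] * f = - ([:[:cb H:]:] * g)"
      using v unfolding val_def by (simp only: eq_neg_iff_add_eq_0)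
    hence "[:[:ca H:]:] * f = [:[:- cb H:]:] * g" using smult_minus_left[of "[:cb H:]" g] by simp
    hence "[:[:1 / ca H:]:] * ([:[:ca H:]:] * f) = [:[:1 / ca H:]:] * ([:[:- cb H:]:] * g)" by simp
    with False show ?thesis
      by (intro that[of "[:[:1 / ca H:]:] * g"] homogeneous_const_mult hom)
         (auto simp: smult_one)
  qed
  have "p \<noteq> 0" using h(2) p by auto
  have "lf H' ^ \<mu> H' dvd p" if H': "H' \<in> A - {H}" for H'
  proof (rule lf_power_dvd_cancel)
    \<comment> \<open>The constant is the determinant of the two forms, nonzero because the lines
      differ.\<close>
    have "val H' f g = [:[:ca H' * - cb H + cb H' * ca H:]:] * p"
      unfolding val_def p mult.assoc[symmetric] distrib_right[symmetric]
      by (intro arg_cong2[where f = "(*)"]) simp_all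
    moreover have "lf H' ^ \<mu> H' dvd val H' f g" using h(1) H' by (simp add: hinD_def inD_def)
    ultimately show "lf H' ^ \<mu> H' dvd [:[:ca H' * - cb H + cb H' * ca H:]:] * p" by simp
    show "ev_on H' [:[:ca H' * - cb H + cb H' * ca H:]:] \<noteq> 0"
      using distinct[OF H, of H'] H' by (auto simp: mult.commute)
  qed (use H' p(1) in auto)
  hence "(\<Prod>H'\<in>A - {H}. lf H' ^ \<mu> H') dvd p" by (intro prod_lf_power_dvd[OF p(1)]) auto
  hence "(\<Sum>H'\<in>A - {H}. \<mu> H') \<le> d"
    by (rule homogeneous_dvdE[OF _ homogeneous_prod[OF homogeneous_lf_power] p(1)])
      (use \<open>p \<noteq> 0\<close> in auto)
  thus ?thesis unfolding msize_def sum.remove[OF finite_A H] by simp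
qed

text \<open>The witness is the derivation along \<open>H\<close> times the powers of the other
  forms; its degree \<open>|\<mu>| - \<mu>_H\<close> is below \<open>|\<mu>| / 2\<close>.\<close>

lemma Delta_pos_of_Lam_H:
  assumes H: "H \<in> A" and "msize A \<mu> < 2 * \<mu> H"
  shows "Delta A lf \<mu> > 0"
proof (rule low_degree_imp_Delta_pos)
  define p where "p = (\<Prod>H'\<in>A - {H}. lf H' ^ \<mu> H')"
  define d where "d = (\<Sum>H'\<in>A - {H}. \<mu> H')"
  have hp: "homogeneous d p" unfolding p_def d_def by (rule homogeneous_prod[OF homogeneous_lf_power])
  have "ev_on H p \<noteq> 0" unfolding p_def ev_on_prod using finite_A H ev_on_lf[OF H] by auto
  hence "p \<noteq> 0" by auto
  thus "p * [:[:- cb H:]:] \<noteq> 0 \<or> p * [:[:ca H:]:] \<noteq> 0" using nonzero[OF H] by auto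
  have "lf H' ^ \<mu> H' dvd val H' (p * [:[:- cb H:]:]) (p * [:[:ca H:]:])" if "H' \<in> A" for H'
  proof (cases "H' = H")
    case True
    have "val H [:[:- cb H:]:] [:[:ca H:]:] = 0" by (simp add: val_def)
    thus ?thesis using True by (simp only: val_mult) simp
  next
    case False
    hence "lf H' ^ \<mu> H' dvd p" unfolding p_def using that finite_A by (intro dvd_prodI) auto
    thus ?thesis unfolding val_mult by (rule dvd_mult2)
  qed
  moreover have "homogeneous d (p * [:[:c:]:])" for c
    using homogeneous_const_mult[OF hp, of c] by (simp only: mult.commute)
  ultimately show "hinD \<mu> d (p * [:[:- cb H:]:]) (p * [:[:ca H:]:])"
    by (auto simp: hinD_def inD_def)
  show "2 * d < msize A \<mu>"
    using assms(2) unfolding d_def msize_def sum.remove[OF finite_A H] by simp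
qed

lemma generator_val_zero:
  assumes H: "H \<in> A" and g: "generator \<mu> d f g" and "val H f g = 0"
  shows "msize A \<mu> < 2 * \<mu> H"
  using hinD_annihilating[OF H _ _ assms(3), of \<mu> d] g by (auto simp: generator_def)

text \<open>The degree satisfies \<open>d < |\<mu>| / 2 \<le> \<mu>_H\<close>, so divisibility by
  \<open>lf H ^ \<mu> H\<close> forces the value 0, which needs a strict majority. Hence no point of
  \<open>\<Lambda>'\<close> has \<open>|\<mu>| = 2 \<mu>_H\<close>.\<close>

lemma generator_balanced:
  assumes H: "H \<in> A" and g: "generator \<mu> d f g" and le: "msize A \<mu> \<le> 2 * \<mu> H"
  shows "msize A \<mu> < 2 * \<mu> H"
proof (rule generator_val_zero[OF H g])
  have h: "hinD \<mu> d f g" "d < \<mu> H" using g le by (auto simp: generator_def)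
  have "lf H ^ \<mu> H dvd val H f g" "homogeneous d (val H f g)"
    using h H by (auto simp: hinD_def inD_def intro: homogeneous_val)
  thus "val H f g = 0"
    by (rule homogeneous_dvdE[OF _ homogeneous_lf_power]) (use h(2) in auto)
qed

lemma homogeneous_degree_0E:
  assumes "homogeneous (d - e) a" "d = (e::nat)" "a * f = p" "a * g = q" "p \<noteq> 0 \<or> q \<noteq> 0"
  obtains c where "c \<noteq> 0" "p = [:[:c:]:] * f" "q = [:[:c:]:] * g"
proof -
  obtain c where "a = [:[:c:]:]" using assms(1,2) by (auto elim: homogeneous_0_const)
  with assms(3-5) show ?thesis by (intro that[of c]) auto
qed

text \<open>The upper generator lies in the lower module, and \<open>lf H\<close> times the lower
  generator lies in the upper one. Minimality on both sides gives
  \<open>d \<le> d' \<le> d + 1\<close>; whichever bound is attained has a factor of degree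
  0.\<close>

lemma generator_Suc:
  assumes H: "H \<in> A" and g: "generator \<mu> d f g" and g': "generator (\<mu>(H := Suc (\<mu> H))) d' f' g'"
  shows "(\<exists>c. c \<noteq> 0 \<and> f' = [:[:c:]:] * f \<and> g' = [:[:c:]:] * g \<and> d' = d) \<or>
    (\<exists>c. c \<noteq> 0 \<and> lf H * f = [:[:c:]:] * f' \<and> lf H * g = [:[:c:]:] * g' \<and> d' = Suc d)"
proof -
  note s = msize_Suc[OF finite_A H, of \<mu>]
  have h: "hinD \<mu> d f g" "f \<noteq> 0 \<or> g \<noteq> 0" "2 * d < msize A \<mu>" using g by (auto simp: generator_def)
  have h': "hinD (\<mu>(H := Suc (\<mu> H))) d' f' g'" "f' \<noteq> 0 \<or> g' \<noteq> 0" "2 * d' \<le> msize A \<mu>"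
    using g' s by (auto simp: generator_def)
  have "hinD \<mu> d' f' g'" using h'(1) by (auto simp: hinD_def elim!: inD_mono)
  hence 1: "d \<le> d' \<and> (\<exists>a. homogeneous (d' - d) a \<and> f' = a * f \<and> g' = a * g)"
    using g h'(2,3) unfolding generator_def by blast
  have "lf H * f \<noteq> 0 \<or> lf H * g \<noteq> 0" using h(2) lf_nonzero[OF H] by auto
  \<comment> \<open>Equality can occur, namely for \<open>msize A \<mu> = 2 * d + 1\<close>; the
    generator property covers it.\<close>
  moreover have "2 * Suc d \<le> msize A (\<mu>(H := Suc (\<mu> H)))" using s h(3) by simp
  ultimately have 2: "d' \<le> Suc d \<and>
      (\<exists>a. homogeneous (Suc d - d') a \<and> lf H * f = a * f' \<and> lf H * g = a * g')"
    using g' hinD_lf_mult[OF h(1), of H] unfolding generator_def by blast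
  show ?thesis
  proof (cases "d' = d")
    case True
    with 1 h'(2) show ?thesis by (metis homogeneous_degree_0E)
  next
    case False
    with 1 2 have "d' = Suc d" by simp
    with 2 \<open>lf H * f \<noteq> 0 \<or> lf H * g \<noteq> 0\<close> show ?thesis by (metis homogeneous_degree_0E)
  qed
qed

section \<open>Relating generators by products of forms\<close>

definition lprod :: "('h \<Rightarrow> nat) \<Rightarrow> 'k poly poly" where
  "lprod k = (\<Prod>H\<in>A. lf H ^ k H)"

lemma lprod_Suc: "H \<in> A \<Longrightarrow> lprod (k(H := Suc (k H))) = lf H * lprod k"
  unfolding lprod_def by (simp add: prod.remove[OF finite_A] mult.assoc)

text \<open>
  Products on both sides avoid dividing by forms, so the relation propagates in both directions
  along an edge without first making \<open>\<theta>\<close> primitive.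
\<close>

definition linked :: "nat \<Rightarrow> 'k poly poly \<Rightarrow> 'k poly poly \<Rightarrow> nat \<Rightarrow> 'k poly poly \<Rightarrow> 'k poly poly \<Rightarrow> bool"
  where "linked d f g d' f' g' \<longleftrightarrow> (\<exists>k l c. c \<noteq> 0 \<and> d' + msize A k = d + msize A l \<and>
     lprod k * f' = [:[:c:]:] * lprod l * f \<and> lprod k * g' = [:[:c:]:] * lprod l * g)"

lemma linkedI:
  "c \<noteq> 0 \<Longrightarrow> d' + msize A k = d + msize A l \<Longrightarrow> lprod k * f' = [:[:c:]:] * lprod l * f \<Longrightarrow>
    lprod k * g' = [:[:c:]:] * lprod l * g \<Longrightarrow> linked d f g d' f' g'"
  unfolding linked_def by blast

lemma linked_refl: "linked d f g d f g"
  by (rule linkedI[of 1 _ "\<lambda>_. 0" _ "\<lambda>_. 0"]) (simp_all add: smult_one)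

lemma linked_const:
  assumes "linked d f g e p q" "c \<noteq> 0" "p' = [:[:c:]:] * p" "q' = [:[:c:]:] * q"
  shows "linked d f g e p' q'"
proof -
  obtain k l b where b: "b \<noteq> 0" "e + msize A k = d + msize A l"
    and eq: "lprod k * p = [:[:b:]:] * lprod l * f" "lprod k * q = [:[:b:]:] * lprod l * g"
    using assms(1) unfolding linked_def by blast
  have cb: "[:[:c * b:]:] = [:[:c:]:] * [:[:b:]:]" by simp
  show ?thesis
  proof (rule linkedI[OF _ b(2)])
    show "c * b \<noteq> 0" using assms(2) b(1) by simp
    show "lprod k * p' = [:[:c * b:]:] * lprod l * f" "lprod k * q' = [:[:c * b:]:] * lprod l * g"
      unfolding assms(3,4) cb mult.left_commute[of "lprod k"] eq by (simp_all only: mult.assoc)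
  qed
qed

text \<open>The extra form goes into \<open>l\<close>, whereas \<open>linked_div\<close> puts it
  into \<open>k\<close>; the degree equation stays balanced in both.\<close>

lemma linked_mult:
  assumes "linked d f g e p q" "H \<in> A"
  shows "linked d f g (Suc e) (lf H * p) (lf H * q)"
proof -
  obtain k l b where b: "b \<noteq> 0" "e + msize A k = d + msize A l"
    and eq: "lprod k * p = [:[:b:]:] * lprod l * f" "lprod k * q = [:[:b:]:] * lprod l * g"
    using assms(1) unfolding linked_def by blast
  show ?thesis
  proof (rule linkedI[OF b(1)])
    show "Suc e + msize A k = d + msize A (l(H := Suc (l H)))"
      using b(2) msize_Suc[OF finite_A assms(2)] by simp
    show "lprod k * (lf H * p) = [:[:b:]:] * lprod (l(H := Suc (l H))) * f"
      "lprod k * (lf H * q) = [:[:b:]:] * lprod (l(H := Suc (l H))) * g"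
      unfolding lprod_Suc[OF assms(2)] mult.left_commute[of "lprod k"] eq by (simp_all only: mult_ac)
  qed
qed

lemma linked_div:
  assumes "linked d f g (Suc e) (lf H * p) (lf H * q)" "H \<in> A"
  shows "linked d f g e p q"
proof -
  obtain k l b where b: "b \<noteq> 0" "Suc e + msize A k = d + msize A l"
    and eq: "lprod k * (lf H * p) = [:[:b:]:] * lprod l * f" "lprod k * (lf H * q) = [:[:b:]:] * lprod l * g"
    using assms(1) unfolding linked_def by blast
  show ?thesis
  proof (rule linkedI[OF b(1)])
    show "e + msize A (k(H := Suc (k H))) = d + msize A l"
      using b(2) msize_Suc[OF finite_A assms(2)] by simp
    show "lprod (k(H := Suc (k H))) * p = [:[:b:]:] * lprod l * f"
      "lprod (k(H := Suc (k H))) * q = [:[:b:]:] * lprod l * g"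
      unfolding lprod_Suc[OF assms(2)] eq[symmetric] by (simp_all only: mult_ac)
  qed
qed

lemma const_inverse_eq:
  assumes "c \<noteq> 0" "p = [:[:c:]:] * q" shows "q = [:[:1 / c:]:] * (p :: 'k poly poly)"
proof -
  have "[:[:1 / c:]:] * p = [:[:1 / c * c:]:] * q" unfolding assms(2) by simp
  also have "1 / c * c = 1" using assms(1) by simp
  finally show ?thesis by (simp add: smult_one)
qed

lemma linked_Suc:
  assumes "H \<in> A" "generator \<mu> e p q" "generator (\<mu>(H := Suc (\<mu> H))) e' p' q'" "linked d f g e p q"
  shows "linked d f g e' p' q'"
  using generator_Suc[OF assms(1-3)]
proof (elim disjE exE conjE)
  fix c assume "c \<noteq> 0" "p' = [:[:c:]:] * p" "q' = [:[:c:]:] * q" "e' = e"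
  thus ?thesis using linked_const[OF assms(4)] by blast
next
  fix c assume "c \<noteq> 0" "lf H * p = [:[:c:]:] * p'" "lf H * q = [:[:c:]:] * q'" "e' = Suc e"
  thus ?thesis using linked_const[OF linked_mult[OF assms(4,1)], of "1 / c" p' q'] const_inverse_eq
    by (metis divide_eq_0_iff one_neq_zero)
qed

lemma linked_pred:
  assumes "H \<in> A" "generator \<mu> e p q" "generator (\<mu>(H := Suc (\<mu> H))) e' p' q'" "linked d f g e' p' q'"
  shows "linked d f g e p q"
  using generator_Suc[OF assms(1-3)]
proof (elim disjE exE conjE)
  fix c assume "c \<noteq> 0" "p' = [:[:c:]:] * p" "q' = [:[:c:]:] * q" "e' = e"
  thus ?thesis using linked_const[OF assms(4), of "1 / c" p q] const_inverse_eq
    by (metis divide_eq_0_iff one_neq_zero)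
next
  fix c assume "c \<noteq> 0" "lf H * p = [:[:c:]:] * p'" "lf H * q = [:[:c:]:] * q'" "e' = Suc e"
  hence "linked d f g (Suc e) (lf H * p) (lf H * q)" using linked_const[OF assms(4)] by blast
  thus ?thesis by (rule linked_div[OF _ assms(1)])
qed

text \<open>Comparing orders along \<open>H\<close> gives
  \<open>\<mu>_H + k_H \<le> l_H + d\<close>, because the nonzero \<open>val H f g\<close> has
  degree \<open>d\<close>. Summing over \<open>A\<close> with \<open>e + |k| = d + |l|\<close>
  leaves \<open>|\<mu>| \<le> e + d * card A\<close>, and \<open>2 e < |\<mu>|\<close> turns this
  into the bound.\<close>

lemma linked_bound:
  assumes f: "homogeneous d f" "homogeneous d g" "\<And>H. H \<in> A \<Longrightarrow> val H f g \<noteq> 0"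
    and p: "generator \<mu> e p q" and l: "linked d f g e p q"
  shows "msize A \<mu> < 2 * d * card A"
proof -
  have D: "inD \<mu> p q" "2 * e < msize A \<mu>" using p by (auto simp: generator_def hinD_def)
  obtain k l b where kl: "b \<noteq> 0" "e + msize A k = d + msize A l"
    "lprod k * p = [:[:b:]:] * lprod l * f" "lprod k * q = [:[:b:]:] * lprod l * g"
    using l unfolding linked_def by blast
  have "\<mu> H + k H \<le> l H + d" if H: "H \<in> A" for H
  proof -
    \<comment> \<open>The part of \<open>lprod m\<close> away from \<open>H\<close>; for
      \<open>m = l\<close> it is cancelled, since it does not vanish on \<open>H\<close>.\<close>
    define Q where "Q m = (\<Prod>H'\<in>A - {H}. lf H' ^ m H')" for m
    have lp: "lprod m = lf H ^ m H * Q m" for m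
      unfolding lprod_def Q_def by (rule prod.remove[OF finite_A H])
    have "ev_on H (Q l) \<noteq> 0" unfolding Q_def ev_on_prod using finite_A H ev_on_lf[OF H] by auto
    hence Q: "ev_on H ([:[:b:]:] * Q l) \<noteq> 0" using kl(1) by (simp only: ev_on_simps) simp
    have hom: "homogeneous (l H + d) (lf H ^ l H * val H f g)"
      by (intro homogeneous_mult homogeneous_lf_power homogeneous_val f)
    have "lprod k * val H p q = [:[:b:]:] * lprod l * val H f g"
      unfolding val_mult[symmetric] kl(3,4) ..
    hence eq: "lf H ^ k H * val H p q * Q k = ([:[:b:]:] * Q l) * (lf H ^ l H * val H f g)"
      unfolding lp by (simp only: mult_ac)
    have "lf H ^ \<mu> H dvd val H p q" using D(1) H by (simp add: inD_def)
    hence "lf H ^ (k H + \<mu> H) dvd lf H ^ k H * val H p q * Q k"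
      unfolding power_add by (intro dvd_mult2 mult_dvd_mono dvd_refl)
    hence "lf H ^ (k H + \<mu> H) dvd lf H ^ l H * val H f g"
      unfolding eq by (rule lf_power_dvd_cancel[OF H hom Q])
    thus ?thesis
      by (rule homogeneous_dvdE[OF _ homogeneous_lf_power hom]) (use f(3)[OF H] lf_nonzero[OF H] in auto)
  qed
  hence "(\<Sum>H\<in>A. \<mu> H + k H) \<le> (\<Sum>H\<in>A. l H + d)" by (rule sum_mono)
  hence "msize A \<mu> + msize A k \<le> msize A l + d * card A"
    by (simp add: msize_def sum.distrib mult.commute)
  with kl(2) D(2) show ?thesis by (simp add: mult.assoc)
qed

section \<open>Finite and infinite components\<close>

lemma Lam'_subset: "Lam' A lf \<subseteq> Lam A"
  by (auto simp: Lam'_def)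

lemma Lam'_generator:
  assumes "\<mu> \<in> Lam' A lf" shows "\<exists>d f g. generator \<mu> d f g"
proof -
  have "Delta A lf \<mu> > 0" using assms by (simp add: Lam'_def)
  then obtain d f g where "generator \<mu> d f g" by (rule Delta_pos_imp_generator)
  thus ?thesis by blast
qed

text \<open>Every generator is related to the fixed start \<open>(f, g)\<close>, not just to its
  neighbour, so the resulting bound depends only on \<open>d\<close> and
  \<open>card A\<close>.\<close>

lemma component_linked:
  assumes g: "generator \<mu> d f g" and "\<nu> \<in> component A (Lam' A lf) \<mu>"
  shows "\<exists>e p q. generator \<nu> e p q \<and> linked d f g e p q"
  using assms(2) unfolding component_def mem_Collect_eq
proof (induction rule: rtrancl_induct)
  case base
  show ?case using g linked_refl by blast
next
  case (step y z)
  then obtain e p q where y: "generator y e p q" "linked d f g e p q" by blast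
  obtain e' p' q' where z: "generator z e' p' q'"
    using step.hyps(2) Lam'_generator by blast
  have "(y, z) \<in> hasse_edges A" using step.hyps(2) by blast
  thus ?case using finite_A
  proof (cases rule: hasse_edgesE)
    case (1 H)
    from linked_Suc[OF 1(1) y(1) z[unfolded 1(2)] y(2)] z show ?thesis by blast
  next
    case (2 H)
    from linked_pred[OF 2(1) z y(1)[unfolded 2(2)] y(2)] z show ?thesis by blast
  qed
qed

text \<open>At a point of \<open>Lam_circ A\<close> the generator annihilates no form, so
  \<open>linked_bound\<close> applies with it as the start.\<close>

lemma finite_component:
  assumes "\<mu> \<in> Lam' A lf" "\<mu> \<in> Lam_circ A"
  shows "finite (component A (Lam' A lf) \<mu>)"
proof -
  obtain d f g where g: "generator \<mu> d f g"
    using assms(1) Lam'_generator by blast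
  have v: "val H f g \<noteq> 0" if "H \<in> A" for H
    using generator_val_zero[OF that g] assms(2) that by (auto simp: Lam_circ_eq Lam_H_iff)
  have hom: "homogeneous d f" "homogeneous d g" using g by (auto simp: generator_def hinD_def)
  have "component A (Lam' A lf) \<mu> \<subseteq> {\<nu> \<in> Lam A. msize A \<nu> < 2 * d * card A}"
    using component_linked[OF g] linked_bound[OF hom v] component_subset[OF assms(1), of A] Lam'_subset
    by blast
  thus ?thesis using finite_Lam_bounded[OF finite_A] finite_subset by blast
qed

lemma Lam_H_subset_Lam': "H \<in> A \<Longrightarrow> Lam_H A H \<subseteq> Lam' A lf"
  using Delta_pos_of_Lam_H by (auto simp: Lam_H_iff Lam'_def)

lemma component_Lam_H:
  assumes H: "H \<in> A" and \<mu>: "\<mu> \<in> Lam_H A H"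
  shows "component A (Lam' A lf) \<mu> = Lam_H A H"
proof (rule component_eqI[OF Lam_H_connected[OF finite_A H] Lam_H_subset_Lam'[OF H] \<mu>])
  fix y z assume yz: "(y, z) \<in> hasse_edges A" "y \<in> Lam_H A H" "z \<in> Lam' A lf"
  have y: "msize A y < 2 * y H" using yz(2) by (simp add: Lam_H_iff)
  have z: "z \<in> Lam A" using yz(3) by (simp add: Lam'_def)
  \<comment> \<open>One unit can weaken the strict majority at most to equality, and
    \<open>generator_balanced\<close> excludes equality in \<open>\<Lambda>'\<close>.\<close>
  have "msize A z \<le> 2 * z H"
    using yz(1) finite_A
  proof (cases rule: hasse_edgesE)
    case (1 H')
    thus ?thesis using msize_Suc[OF finite_A 1(1), of y] y by (auto simp: fun_upd_def)
  next
    case (2 H')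
    thus ?thesis using msize_Suc[OF finite_A 2(1), of z] y by (auto simp: fun_upd_def split: if_splits)
  qed
  moreover obtain d f g where "generator z d f g"
    using yz(3) Lam'_generator by blast
  ultimately show "z \<in> Lam_H A H" using generator_balanced[OF H] z by (simp add: Lam_H_iff)
qed

lemma component_cases:
  assumes "\<mu> \<in> Lam' A lf"
  obtains "\<mu> \<in> Lam_circ A" "finite (component A (Lam' A lf) \<mu>)"
    "component A (Lam' A lf) \<mu> \<subseteq> Lam_circ A"
  | H where "H \<in> A" "component A (Lam' A lf) \<mu> = Lam_H A H"
proof (cases "\<mu> \<in> Lam_circ A")
  case True
  note fin = finite_component[OF assms True]
  have "\<nu> \<in> Lam_circ A" if \<nu>: "\<nu> \<in> component A (Lam' A lf) \<mu>" for \<nu>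
  proof (rule ccontr)
    assume "\<nu> \<notin> Lam_circ A"
    moreover have "\<nu> \<in> Lam A" using \<nu> component_subset[OF assms, of A] Lam'_subset by blast
    ultimately obtain H where H: "H \<in> A" "\<nu> \<in> Lam_H A H" by (auto simp: Lam_circ_eq)
    \<comment> \<open>Reachability is symmetric, so a component meeting \<open>Lam_H A H\<close>
      equals it and would contain \<open>\<mu>\<close>.\<close>
    have "(\<nu>, \<mu>) \<in> (hasse_edges A \<inter> Lam' A lf \<times> Lam' A lf)\<^sup>*"
      using \<nu> sym_hasse_rtrancl[of A "Lam' A lf"] by (simp add: component_def symD)
    hence "\<mu> \<in> Lam_H A H" using component_Lam_H[OF H] by (auto simp: component_def)
    thus False using True H(1) by (auto simp: Lam_circ_eq)
  qed
  with True fin show ?thesis by (intro that(1)) auto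
next
  case False
  then obtain H where "H \<in> A" "\<mu> \<in> Lam_H A H" using assms Lam'_subset by (auto simp: Lam_circ_eq)
  thus ?thesis using component_Lam_H that(2) by blast
qed

lemma Delta_zero_component:
  assumes "\<mu> \<in> Lam A - Lam' A lf"
  shows "component A (Lam A - Lam' A lf) \<mu> = {\<mu>}"
proof (rule component_eqI)
  show "hasse_connected A {\<mu>}" using assms by (auto simp: hasse_connected_def)
  fix y z assume yz: "(y, z) \<in> hasse_edges A" "y \<in> {\<mu>}" "z \<in> Lam A - Lam' A lf"
  have "Delta A lf \<nu> = 0" if "\<nu> \<in> Lam A - Lam' A lf" for \<nu>
    using that Delta_nonneg[of \<nu>] by (auto simp: Lam'_def)
  hence "even (msize A y)" "even (msize A z)" using yz assms even_Delta_iff by fastforce+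
  hence False using yz(1) by (auto simp: hasse_edges_def mcover_def)
  thus "z \<in> {\<mu>}" ..
qed (use assms in auto)

lemma components_of_Lam':
  "(\<forall>C \<in> max_components A (Lam' A lf). finite C \<longrightarrow> C \<subseteq> Lam_circ A) \<and>
     \<Union>{C \<in> max_components A (Lam' A lf). finite C} = Lam_circ A \<inter> Lam' A lf"
  "{C \<in> max_components A (Lam' A lf). infinite C} = Lam_H A ` A"
  "Lam A - Lam' A lf = {\<mu> \<in> Lam A. Delta A lf \<mu> = 0}"
  "\<forall>C \<in> max_components A (Lam A - Lam' A lf). \<exists>\<mu>. C = {\<mu>}"
proof -
  let ?c = "component A (Lam' A lf)"
  note M = max_components_eq[OF Lam'_subset]
  have inf: "infinite (Lam_H A H)" if "H \<in> A" for H using infinite_Lam_H[OF finite_A that] .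
  have fin: "finite (?c \<mu>) \<longleftrightarrow> \<mu> \<in> Lam_circ A" "finite (?c \<mu>) \<Longrightarrow> ?c \<mu> \<subseteq> Lam_circ A"
    if "\<mu> \<in> Lam' A lf" for \<mu>
  proof -
    have "\<mu> \<in> ?c \<mu>" by (simp add: component_def)
    have "(finite (?c \<mu>) \<longleftrightarrow> \<mu> \<in> Lam_circ A) \<and> (finite (?c \<mu>) \<longrightarrow> ?c \<mu> \<subseteq> Lam_circ A)"
    proof (rule component_cases[OF that])
      fix H assume H: "H \<in> A" "?c \<mu> = Lam_H A H"
      with \<open>\<mu> \<in> ?c \<mu>\<close> show ?thesis using inf[OF H(1)] by (auto simp: Lam_circ_eq)
    qed simp
    thus "finite (?c \<mu>) \<longleftrightarrow> \<mu> \<in> Lam_circ A" "finite (?c \<mu>) \<Longrightarrow> ?c \<mu> \<subseteq> Lam_circ A" by blast+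
  qed
  have mem: "\<mu> \<in> ?c \<mu>" for \<mu> by (simp add: component_def)
  show "(\<forall>C \<in> max_components A (Lam' A lf). finite C \<longrightarrow> C \<subseteq> Lam_circ A) \<and>
     \<Union>{C \<in> max_components A (Lam' A lf). finite C} = Lam_circ A \<inter> Lam' A lf"
    unfolding M using fin mem component_subset[of _ "Lam' A lf" A] by blast
  show "{C \<in> max_components A (Lam' A lf). infinite C} = Lam_H A ` A"
  proof (intro equalityI subsetI)
    fix C assume "C \<in> {C \<in> max_components A (Lam' A lf). infinite C}"
    then obtain \<mu> where "\<mu> \<in> Lam' A lf" "C = ?c \<mu>" "infinite C" unfolding M by blast
    thus "C \<in> Lam_H A ` A" using component_cases[of \<mu> "C \<in> Lam_H A ` A"] by blast
  next
    fix C assume "C \<in> Lam_H A ` A"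
    then obtain H where H: "H \<in> A" "C = Lam_H A H" by blast
    then obtain \<mu> where \<mu>: "\<mu> \<in> Lam_H A H" using inf by (metis ex_in_conv finite.emptyI)
    hence "C = ?c \<mu>" "\<mu> \<in> Lam' A lf"
      using component_Lam_H[OF H(1) \<mu>] H Lam_H_subset_Lam'[OF H(1)] by auto
    hence "C \<in> ?c ` Lam' A lf" by (rule image_eqI)
    moreover have "infinite C" using inf[OF H(1)] H(2) by simp
    ultimately show "C \<in> {C \<in> max_components A (Lam' A lf). infinite C}" unfolding M by simp
  qed
  show "Lam A - Lam' A lf = {\<mu> \<in> Lam A. Delta A lf \<mu> = 0}"
    using Delta_nonneg by (auto simp: Lam'_def not_less antisym)
  show "\<forall>C \<in> max_components A (Lam A - Lam' A lf). \<exists>\<mu>. C = {\<mu>}"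
    using Delta_zero_component by (auto simp: max_components_eq)
qed

end

section \<open>From linear forms on V to coordinates\<close>

lemma line_arrangement_of_forms:
  fixes scale :: "'k::field \<Rightarrow> 'v::ab_group_add \<Rightarrow> 'v"
  assumes V: "vector_space scale" "vector_space.dim scale UNIV = 2"
    and span: "module.span scale {e1, e2} = UNIV"
    and finite: "finite A"
    and lines: "\<And>H. H \<in> A \<Longrightarrow> vector_space.dim scale H = 1"
    and forms: "\<And>H. H \<in> A \<Longrightarrow> Vector_Spaces.linear scale (*) (\<alpha> H) \<and> {v. \<alpha> H v = 0} = H"
  shows "line_arrangement A (\<lambda>H. \<alpha> H e1) (\<lambda>H. \<alpha> H e2)"
proof
  interpret vector_space scale by (rule V(1))
  have expand: "\<exists>x y. \<forall>H\<in>A. \<alpha> H v = x * \<alpha> H e1 + y * \<alpha> H e2" for v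
  proof -
    have "v \<in> module.span scale {e1, e2}" using span by simp
    then obtain x y where v: "v - scale x e1 = scale y e2"
      by (auto simp: span_insert span_singleton)
    have "v = scale x e1 + scale y e2" using v by (metis diff_add_cancel add.commute)
    moreover have "\<alpha> H (a + b) = \<alpha> H a + \<alpha> H b" "\<alpha> H (scale r a) = r * \<alpha> H a" if "H \<in> A" for H a b r
      using forms[OF that] by (auto simp: Vector_Spaces.linear_iff)
    ultimately show ?thesis by auto
  qed
  show nz: "\<alpha> H e1 \<noteq> 0 \<or> \<alpha> H e2 \<noteq> 0" if H: "H \<in> A" for H
  proof (rule ccontr)
    assume "\<not> ?thesis"
    hence "\<alpha> H v = 0" for v using expand[of v] H by auto
    \<comment> \<open>A form vanishing on both basis vectors has kernel \<open>V\<close>, of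
      dimension 2 instead of 1.\<close>
    hence "H = UNIV" using forms[OF H] by auto
    thus False using lines[OF H] V(2) by simp
  qed
  show "\<alpha> H e1 * \<alpha> H' e2 \<noteq> \<alpha> H e2 * \<alpha> H' e1" if H: "H \<in> A" "H' \<in> A" "H \<noteq> H'" for H H'
  proof
    assume eq: "\<alpha> H e1 * \<alpha> H' e2 = \<alpha> H e2 * \<alpha> H' e1"
    have "\<alpha> H v = 0 \<longleftrightarrow> \<alpha> H' v = 0" for v
    proof -
      obtain x y where xy: "\<alpha> H v = x * \<alpha> H e1 + y * \<alpha> H e2" "\<alpha> H' v = x * \<alpha> H' e1 + y * \<alpha> H' e2"
        using expand[of v] H by blast
      \<comment> \<open>Proportional coefficients make the two values proportional, so the kernels
        agree.\<close>
      have "\<alpha> H e1 * \<alpha> H' v = \<alpha> H' e1 * \<alpha> H v" "\<alpha> H e2 * \<alpha> H' v = \<alpha> H' e2 * \<alpha> H v"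
        unfolding xy using eq by algebra+
      thus ?thesis using nz[OF H(1)] nz[OF H(2)] by auto
    qed
    hence "{v. \<alpha> H v = 0} = {v. \<alpha> H' v = 0}" by simp
    hence "H = H'" unfolding conjunct2[OF forms[OF H(1)]] conjunct2[OF forms[OF H(2)]] .
    with H(3) show False ..
  qed
qed (rule finite)

theorem theorem3p1:
  fixes scale :: "'k::field \<Rightarrow> 'v::ab_group_add \<Rightarrow> 'v"
    and e1 e2 :: 'v
    and A :: "'v set set"
    and \<alpha> :: "'v set \<Rightarrow> 'v \<Rightarrow> 'k"
    and a :: "'v set \<Rightarrow> 'k poly poly"
  assumes V: "vector_space scale" "vector_space.dim scale UNIV = 2"
    and basis: "e1 \<noteq> e2" "\<not> module.dependent scale {e1, e2}" "module.span scale {e1, e2} = UNIV"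
    and finite: "finite A"
    and lines: "\<And>H. H \<in> A \<Longrightarrow> module.subspace scale H \<and> vector_space.dim scale H = 1"
    and forms: "\<And>H. H \<in> A \<Longrightarrow> Vector_Spaces.linear scale (*) (\<alpha> H) \<and> {v. \<alpha> H v = 0} = H"
    and a: "\<And>H. a H = form_poly e1 e2 (\<alpha> H)"
  shows "((\<forall>C \<in> max_components A (Lam' A a). finite C \<longrightarrow> C \<subseteq> Lam_circ A) \<and>
          \<Union>{C \<in> max_components A (Lam' A a). finite C} = Lam_circ A \<inter> Lam' A a) \<and>
         {C \<in> max_components A (Lam' A a). infinite C} = Lam_H A ` A \<and>
         (Lam A - Lam' A a = {\<mu> \<in> Lam A. Delta A a \<mu> = 0} \<and>
          (\<forall>C \<in> max_components A (Lam A - Lam' A a). \<exists>\<mu>. C = {\<mu>}))"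
proof -
  interpret L: line_arrangement A "\<lambda>H. \<alpha> H e1" "\<lambda>H. \<alpha> H e2"
    using line_arrangement_of_forms[OF V basis(3) finite _ forms] lines by blast
  have "a = L.lf" by (rule ext) (simp add: a form_poly_def L.lf_def)
  thus ?thesis using L.components_of_Lam' by simp
qed

end
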